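(* Assume $\lambda_{\mathcal T_0}(\gamma)\le \frac{1}{6\Lambda_0L^3}$. Let $\theta\in(0,1]$ be the marking parameter of MARK and assume that the AFEM parameter $\omega>0$ satisfies $\omega\le\min\{\omega_1,\omega_2\}$, where $$\omega_1=\sqrt{\frac{C_2}{2\Lambda_0^2\Lambda_1}},\qquad \omega_2=\frac{\xi\theta^2}{\Lambda_0\sqrt{32\Lambda_2(2\Lambda_3+1)}},\qquad \xi=1-2^{-b/d}.$$ Then there exist constants $0<\alpha<1$ and $\beta>0$ such that the following holds. Let $\{\mathcal T^j,U^j\}_{j=0}^J$ be the sequence of meshes and Galerkin solutions produced by one call ADAPT\_PDE$(\mathcal T^0,\varepsilon)$ inside AFEM (i.e. $\mathcal T^0=\mathcal T_k^+$, $\varepsilon=\varepsilon_k$ for some $k\ge0$, so that $\lambda_{\mathcal T^0}(\gamma)\le\omega\varepsilon$). With $e^j:=\|\nabla_\gamma(u-U^j)\|_{L_2(\gamma)}$ and $\eta^j:=\eta_{\mathcal T^j}(U^j,F_{\Gamma^j})$, where $\Gamma^j=\Gamma_{\mathcal T^j}$, $$(e^{j+1})^2+\beta(\eta^{j+1})^2\le\alpha^2\big((e^j)^2+\beta(\eta^j)^2\big)\qquad\forall\,0\le j<J .$$ Moreover, the number $J$ of inner iterates of ADAPT\_PDE is uniformly bounded (i.e. bounded independently of the outer iteration counter $k$).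
   Context: **Surface.** $d,n\ge1$ are integers; $\Omega\subset\mathbb R^d$ is a closed reference simplex. $\overline\Gamma_0=\bigcup_{i=1}^M\overline\Gamma_0^i\subset\mathbb R^{d+1}$ is a $d$-dimensional polyhedral surface (with or without boundary) whose faces $\overline\Gamma_0^i=X_0^i(\Omega)$ ($X_0^i$ affine) are simplices forming a conforming triangulation $\overline{\mathcal T}_0$. $P_0:\overline\Gamma_0\to\gamma\subset\mathbb R^{d+1}$ is a Lipschitz homeomorphism fixing the vertices of $\overline\Gamma_0$; $\chi^i:=P_0\circ X_0^i:\Omega\to\gamma^i:=P_0(\overline\Gamma_0^i)$ is $C^1$ on $\Omega$ and satisfies $L^{-1}|\hat x-\hat y|\le|\chi^i(\hat x)-\chi^i(\hat y)|\le L|\hat x-\hat y|$ with $L\ge1$. The index $i$ is dropped when harmless. **Meshes.** $\overline{\mathbb T}$ is the set of conforming triangulations obtained from $\overline{\mathcal T}_0$ by successive bisections. Each $\overline{\mathcal T}\in\overline{\mathbb T}$ induces via $(X_0^i)^{-1}$ triangulations $\widehat{\mathcal T}^i$ of $\Omega$. With $I_{\mathcal T^i}$ the Lagrange interpolation operator onto continuous piecewise polynomials of degree $\le n$ over $\widehat{\mathcal T}^i$, set $X^i_{\mathcal T}:=I_{\mathcal T^i}\chi^i$, $\Gamma^i:=X^i_{\mathcal T}(\Omega)$, $\mathcal T^i:=\{T=X^i_{\mathcal T}(\widehat T):\widehat T\in\widehat{\mathcal T}^i\}$, $\mathcal T:=\bigcup_i\mathcal T^i$, $\Gamma=\Gamma_{\mathcal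 T}:=\bigcup_i\Gamma^i$. $\mathbb T$ is the set of all such $\mathcal T$; $\mathcal T_0$ corresponds to $\overline{\mathcal T}_0$; $\mathcal T_*\ge\mathcal T$ means $\mathcal T_*$ is a refinement of $\mathcal T$; elements of two meshes are identified when the corresponding flat elements agree. For $T\in\mathcal T$, $\widehat T$ is the corresponding flat element and $h_T:=|\widehat T|^{1/d}$. Functions on $\gamma$, $\Gamma$ and the $M$ copies of $\Omega$ are identified patchwise through $\chi^i$ and $X^i_{\mathcal T}$. $\mathbb V(\mathcal T)$: continuous functions on $\Gamma$ whose pullbacks by $X^i_{\mathcal T}$ are piecewise polynomials of degree $\le n$ over $\widehat{\mathcal T}^i$, vanishing on $\partial\Gamma$, or with $\int_\Gamma V=0$ if $\partial\Gamma=\emptyset$. **Geometric estimator.** $\lambda_{\mathcal T}(\gamma,T):=\|\widehat\nabla(\chi^i-X^i_{\mathcal T})\|_{L_\infty(\widehat T)}$ for $T\in\mathcal T^i$, $\lambda_{\mathcal T}(\gamma):=\max_{T}\lambda_{\mathcal T}(\gamma,T)$. $\Lambda_0>1$ is a constant with $\lambda_{\mathcal T_*}(\gamma)\le\Lambda_0\lambda_{\mathcal T}(\gamma)$ (and elementwise) for all $\mathcal T_*\ge\mathcal T$ in $\mathbb T$. **Geometry.** $G:=(\widehat\nabla\chi)^T\widehat\nabla\chi$ ($\widehat\nabla\chi$ the $(d+1)\times d$ Jacobian), $q:=\sqrt{\det G}$, $G_\Gamma:=(\widehat\nabla X_{\mathcal T})^T\widehat\nabla X_{\mathcal T}$, $q_\Gamma:=\sqrt{\det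 G_\Gamma}$. Surface gradients (row vectors): $\nabla_\gamma v=\widehat\nabla v\,G^{-1}(\widehat\nabla\chi)^T$, $\nabla_\Gamma v=\widehat\nabla v\,G_\Gamma^{-1}(\widehat\nabla X_{\mathcal T})^T$; elementwise $\Delta_\Gamma V=q_\Gamma^{-1}\widehat{\mathrm{div}}(q_\Gamma\widehat\nabla V\,G_\Gamma^{-1})$. **Problem.** $f\in L_2(\gamma)$, with $\int_\gamma f=0$ if $\partial\gamma=\emptyset$. $H^1_\#(\gamma)$: functions in $H^1(\gamma)$ vanishing on $\partial\gamma$, or with zero mean if $\partial\gamma=\emptyset$. $u\in H^1_\#(\gamma)$ solves $\int_\gamma\nabla_\gamma u\nabla_\gamma^T\varphi=\int_\gamma f\varphi$ for all $\varphi\in H^1_\#(\gamma)$. With $F_\Gamma:=f\,q/q_\Gamma$, the Galerkin solution $U\in\mathbb V(\mathcal T)$ solves $\int_\Gamma\nabla_\Gamma U\nabla_\Gamma^TV=\int_\Gamma F_\Gamma V$ for all $V\in\mathbb V(\mathcal T)$. **Estimator and oscillation.** $\eta_{\mathcal T}(V,F_\Gamma,T)^2:=h_T^2\|F_\Gamma+\Delta_\Gamma V\|_{L_2(T)}^2+h_T\|\mathcal J(V)\|_{L_2(\partial T)}^2$, where on each interior face $S=T^+\cap T^-$, $\mathcal J(V)=\nabla_\Gamma V^+n_S^++\nabla_\Gamma V^-n_S^-$ with $n_S^\pm$ the outward unit co-normals of $T^\pm$ (only interior faces contribute). $$\mathrm{osc}_{\mathcal T}(V,f,T)^2:=h_T^2\|(\mathrm{id}-\Pi^2_{2n-2})(fq+\widehat{\mathrm{div}}(q_\Gamma\widehat\nabla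 V G_\Gamma^{-1}))\|_{L_2(\widehat T)}^2+h_T\|(\mathrm{id}-\Pi^2_{2n-1})(q_\Gamma^+\widehat\nabla V^+(G_\Gamma^+)^{-1}\hat n^++q_\Gamma^-\widehat\nabla V^-(G_\Gamma^-)^{-1}\hat n^-)\|_{L_2(\partial\widehat T)}^2,$$ with $\Pi^2_m$ the $L_2$-best approximation onto polynomials of degree $\le m$ and $\hat n^\pm$ the outward unit normals of $\widehat T^\pm$ (interior faces only). For $\tau\subset\mathcal T$, $\eta_{\mathcal T}(V,F_\Gamma,\tau)$ and $\mathrm{osc}_{\mathcal T}(V,f,\tau)$ are the $\ell_2$-sums over $T\in\tau$; $\tau$ is omitted if $\tau=\mathcal T$. **Algorithms.** REFINE$(\mathcal T,\mathcal M)$ bisects every element of $\mathcal M\subset\mathcal T$ at least $b\ge1$ times and performs the additional bisections needed for conformity. MARK outputs $\mathcal M\subset\mathcal T$ with $\eta_{\mathcal T}(U,F_\Gamma,\mathcal M)\ge\theta\,\eta_{\mathcal T}(U,F_\Gamma)$. ADAPT\_SURFACE$(\mathcal T,\varepsilon)$: while $\mathcal M:=\{T\in\mathcal T:\lambda_{\mathcal T}(\gamma,T)>\varepsilon\}\neq\emptyset$, set $\mathcal T=$ REFINE$(\mathcal T,\mathcal M)$; return $\mathcal T$. ADAPT\_PDE$(\mathcal T,\varepsilon)$: compute $U$ on $\mathcal T$ exactly; if $\eta_{\mathcal T}(U,F_\Gamma)<\varepsilon$ return $(U,\mathcal T)$; else $\mathcal M=$ MARK, $\mathcal T=$ REFINE$(\mathcal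 T,\mathcal M)$, repeat; $\mathcal T^j,U^j$ denote the successive meshes and Galerkin solutions, $\mathcal T^0$ being the input and $j=J$ the returned one. AFEM: given $\mathcal T_0$, $\varepsilon_0>0$, $0<\rho<1$, $\omega>0$; for $k=0,1,\dots$: $\mathcal T_k^+=$ ADAPT\_SURFACE$(\mathcal T_k,\omega\varepsilon_k)$; $[U_{k+1},\mathcal T_{k+1}]=$ ADAPT\_PDE$(\mathcal T_k^+,\varepsilon_k)$; $\varepsilon_{k+1}=\rho\varepsilon_k$. **Constants.** $C_1,C_2,\Lambda_1,\Lambda_2,\Lambda_3>0$ are constants (depending only on $\mathcal T_0$, $L$, $\|f\|_{L_2(\gamma)}$) for which the following known estimates hold for all $\mathcal T\le\mathcal T_*$ in $\mathbb T$, with Galerkin solutions $U,U_*$ on $\Gamma,\Gamma_*$: (a) $\|\nabla_\gamma(u-U)\|^2_{L_2(\gamma)}\le C_1\eta_{\mathcal T}(U,F_\Gamma)^2+\Lambda_1\lambda_{\mathcal T}(\gamma)^2$; (b) $C_2\eta_{\mathcal T}(U,F_\Gamma)^2\le\|\nabla_\gamma(u-U)\|^2_{L_2(\gamma)}+\mathrm{osc}_{\mathcal T}(U,f)^2+\Lambda_1\lambda_{\mathcal T}(\gamma)^2$; (c) if all elements of $\mathcal M\subset\mathcal T$ are bisected at least $b$ times in passing to $\mathcal T_*$, then for every $\delta>0$, $\eta_{\mathcal T_*}(U_*,F_{\Gamma_*})^2\le(1+\delta)(\eta_{\mathcal T}(U,F_\Gamma)^2-\xi\eta_{\mathcal T}(U,F_\Gamma,\mathcal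 M)^2)+(1+\delta^{-1})(\Lambda_3\|\nabla_\gamma(U_*-U)\|^2_{L_2(\gamma)}+\Lambda_2\lambda_{\mathcal T}(\gamma)^2)$; (d) for $\lambda\in\{\lambda_{\mathcal T}(\gamma),\lambda_{\mathcal T_*}(\gamma)\}$ and $E:=\|\nabla_\gamma(U_*-U)\|_{L_2(\gamma)}$: $\|\nabla_\gamma(u-U)\|^2-\tfrac32E^2-\Lambda_2\lambda^2\le\|\nabla_\gamma(u-U_* )\|^2\le\|\nabla_\gamma(u-U)\|^2-\tfrac12E^2+\Lambda_2\lambda^2$ (norms in $L_2(\gamma)$). *)

theory Defs
  imports
    "HOL-Analysis.Analysis"
    "HOL-Probability.Essential_Supremum"
    "HOL-Library.Sublist"
    "HOL-Library.Extended_Nat"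
begin

section \<open>Hausdorff measure\<close>

text \<open>The normalisation makes \<open>hausdorff_measure s\<close> coincide with the \<open>s\<close>-dimensional surface
  measure; for \<open>s = 0\<close> it is the counting measure (recall \<open>0 ^ 0 = 1\<close>).\<close>

definition hausdorff_cost :: "nat \<Rightarrow> 'a::metric_space set \<Rightarrow> ennreal" where
  "hausdorff_cost s C =
     (if C = {} then 0 else ennreal (unit_ball_vol (real s) * (diameter C / 2) ^ s))"

definition hausdorff_pre :: "nat \<Rightarrow> real \<Rightarrow> 'a::metric_space set \<Rightarrow> ennreal" where
  "hausdorff_pre s \<delta> A =
     Inf {(\<Sum>n. hausdorff_cost s (C n)) | C :: nat \<Rightarrow> 'a set.
            A \<subseteq> (\<Union>n. C n) \<and> (\<forall>n. bounded (C n) \<and> diameter (C n) \<le> \<delta>)}"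

definition hausdorff_measure :: "nat \<Rightarrow> 'a::metric_space measure" where
  "hausdorff_measure s = measure_of UNIV (sets borel) (\<lambda>A. SUP \<delta>\<in>{0<..}. hausdorff_pre s \<delta> A)"


section \<open>Polynomials and derivatives on subsets of \<open>\<real>\<^sup>d\<close>\<close>

definition poly_space :: "nat \<Rightarrow> (real^'d \<Rightarrow> real) set" where
  "poly_space m =
     {p. \<exists>c. p = (\<lambda>x. \<Sum>a | (\<Sum>k\<in>UNIV. a k) \<le> m. c a * (\<Prod>k\<in>UNIV. (x $ k) ^ (a k :: nat)))}"

definition L2_proj :: "(real^'d) measure \<Rightarrow> nat \<Rightarrow> (real^'d \<Rightarrow> real) \<Rightarrow> real^'d \<Rightarrow> real" where
  "L2_proj \<mu> m g = arg_min (\<lambda>p. LINT x|\<mu>. (g x - p x)\<^sup>2) (\<lambda>p. p \<in> poly_space m)"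

text \<open>Derivatives are taken within the (full-dimensional, convex) set \<open>S\<close>, so that they are
  uniquely determined, and one-sided, on the boundary of \<open>S\<close>.\<close>

definition grad_on :: "(real^'d) set \<Rightarrow> (real^'d \<Rightarrow> real) \<Rightarrow> real^'d \<Rightarrow> real^'d" where
  "grad_on S v x = (\<chi> k. frechet_derivative v (at x within S) (axis k 1))"

definition jac_on :: "(real^'d) set \<Rightarrow> (real^'d \<Rightarrow> real^'m) \<Rightarrow> real^'d \<Rightarrow> real^'d^'m" where
  "jac_on S X x = matrix (frechet_derivative X (at x within S))"

definition div_on :: "(real^'d) set \<Rightarrow> (real^'d \<Rightarrow> real^'d) \<Rightarrow> real^'d \<Rightarrow> real" where
  "div_on S W x = trace (jac_on S W x)"

definition C1_on :: "(real^'d) set \<Rightarrow> (real^'d \<Rightarrow> real^'m) \<Rightarrow> bool" where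
  "C1_on S X \<longleftrightarrow> (\<exists>X'. continuous_on S X' \<and>
      (\<forall>x\<in>S. (X has_derivative (\<lambda>h. X' x *v h)) (at x within S)))"

definition metric :: "real^'d^'m \<Rightarrow> real^'d^'d" where
  "metric J = transpose J ** J"

definition area_el :: "real^'d^'m \<Rightarrow> real" where
  "area_el J = sqrt (det (metric J))"

definition surf_grad :: "real^'d^'m \<Rightarrow> real^'d \<Rightarrow> real^'m" where
  "surf_grad J g = g v* (matrix_inv (metric J) ** transpose J)"

definition test_function :: "(real^'d) set \<Rightarrow> (real^'d \<Rightarrow> real) \<Rightarrow> bool" where
  "test_function S \<phi> \<longleftrightarrow>
     (\<exists>\<phi>'. continuous_on UNIV \<phi>' \<and> (\<forall>x. (\<phi> has_derivative (\<lambda>h. \<phi>' x \<bullet> h)) (at x))) \<and>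
     compact (closure {x. \<phi> x \<noteq> 0}) \<and> closure {x. \<phi> x \<noteq> 0} \<subseteq> interior S"

definition weak_gradient ::
    "(real^'d) set \<Rightarrow> (real^'d \<Rightarrow> real) \<Rightarrow> (real^'d \<Rightarrow> real^'d) \<Rightarrow> bool" where
  "weak_gradient S v g \<longleftrightarrow>
     integrable (lebesgue_on S) v \<and> integrable (lebesgue_on S) g \<and>
     (\<forall>\<phi>. test_function S \<phi> \<longrightarrow> (\<forall>k.
        (LINT x|lebesgue_on S. v x * grad_on UNIV \<phi> x $ k) =
        - (LINT x|lebesgue_on S. g x $ k * \<phi> x)))"

definition wgrad :: "(real^'d) set \<Rightarrow> (real^'d \<Rightarrow> real) \<Rightarrow> real^'d \<Rightarrow> real^'d" where
  "wgrad S v = (SOME g. weak_gradient S v g)"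


section \<open>Bisection\<close>

text \<open>A tagged simplex \<open>(z\<^sub>0,\<dots>,z\<^sub>d)\<^sub>t\<close> is bisected at the midpoint of \<open>z\<^sub>0 z\<^sub>d\<close>; vertex order and
  type of the two children follow the newest vertex rule of Maubach, Traxler and Stevenson.\<close>

fun bisect_child :: "(real^'d) list \<times> nat \<Rightarrow> bool \<Rightarrow> (real^'d) list \<times> nat" where
  "bisect_child (zs, t) c =
     (let z = midpoint (hd zs) (last zs); ys = butlast (tl zs) in
       (if c then last zs # z # take t ys @ rev (drop t ys) else hd zs # z # ys,
        Suc t mod CARD('d)))"

text \<open>A flat element is a node \<open>(i, p)\<close> of the bisection forest: \<open>i\<close> is the patch and the address
  \<open>p\<close> lists which child is taken at each of the \<open>length p\<close> bisections leading to the element. A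
  mesh is a set of nodes, so that equal elements of different meshes are literally equal.\<close>

type_synonym node = "nat \<times> bool list"

inductive bisection :: "node set \<Rightarrow> node set \<Rightarrow> bool" where
  "(i, p) \<in> A \<Longrightarrow> bisection A (A - {(i, p)} \<union> {(i, p @ [False]), (i, p @ [True])})"

abbreviation refined_to :: "node set \<Rightarrow> node set \<Rightarrow> bool" where
  "refined_to A B \<equiv> bisection\<^sup>*\<^sup>* A B"

definition descendant :: "node \<Rightarrow> node \<Rightarrow> bool" where
  "descendant K K' \<longleftrightarrow> fst K' = fst K \<and> prefix (snd K) (snd K')"

definition bisected_at_least :: "nat \<Rightarrow> node set \<Rightarrow> node set \<Rightarrow> bool" where
  "bisected_at_least b M B \<longleftrightarrow>
     (\<forall>K\<in>M. \<forall>K'\<in>B. descendant K K' \<longrightarrow> length (snd K) + b \<le> length (snd K'))"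


section \<open>Parametric surface\<close>

text \<open>\<open>Omega\<close> is the reference simplex, \<open>X0 i\<close> (\<open>i < npatch\<close>) the affine parametrisations of the
  faces of the polyhedral surface, \<open>P0\<close> its lift to \<open>\<gamma>\<close>, and \<open>tag0 i\<close> the initial ordering of the
  vertices (in reference coordinates) and type of face \<open>i\<close>.\<close>

record ('d, 'm) surface =
  Omega :: "(real^'d) set"
  npatch :: nat
  X0 :: "nat \<Rightarrow> real^'d \<Rightarrow> real^'m"
  P0 :: "real^'m \<Rightarrow> real^'m"
  tag0 :: "nat \<Rightarrow> (real^'d) list \<times> nat"

definition flat_surface :: "('d::finite, 'm::finite) surface \<Rightarrow> (real^'m) set" where
  "flat_surface S = (\<Union>i<npatch S. X0 S i ` Omega S)"

definition exact_surface :: "('d::finite, 'm::finite) surface \<Rightarrow> (real^'m) set" where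
  "exact_surface S = P0 S ` flat_surface S"

definition chart :: "('d::finite, 'm::finite) surface \<Rightarrow> nat \<Rightarrow> real^'d \<Rightarrow> real^'m" where
  "chart S i x = P0 S (X0 S i x)"

definition param_surface :: "('d::finite, 'm::finite) surface \<Rightarrow> real \<Rightarrow> bool" where
  "param_surface S L \<longleftrightarrow>
     CARD('m) = CARD('d) + 1 \<and>
     (int CARD('d)) simplex (Omega S) \<and>
     1 \<le> npatch S \<and>
     (\<forall>i<npatch S. (\<exists>A c. \<forall>x. X0 S i x = A *v x + c) \<and> inj_on (X0 S i) (Omega S)) \<and>
     (\<forall>i<npatch S. distinct (fst (tag0 S i)) \<and>
        set (fst (tag0 S i)) = {z. z extreme_point_of Omega S} \<and> snd (tag0 S i) < CARD('d)) \<and>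
     \<comment> \<open>conforming triangulation with distinct faces, forming a manifold with or without boundary\<close>
     triangulation ((\<lambda>i. X0 S i ` Omega S) ` {..<npatch S}) \<and>
     inj_on (\<lambda>i. X0 S i ` Omega S) {..<npatch S} \<and>
     (\<forall>y\<in>flat_surface S. \<exists>N W. y \<in> N \<and> openin (top_of_set (flat_surface S)) N \<and>
        (\<exists>k. openin (top_of_set {x :: real^'d. 0 \<le> x $ k}) W) \<and> N homeomorphic W) \<and>
     (\<exists>Q. homeomorphism (flat_surface S) (exact_surface S) (P0 S) Q) \<and>
     (\<exists>C. C-lipschitz_on (flat_surface S) (P0 S)) \<and>
     (\<forall>i<npatch S. \<forall>z. z extreme_point_of Omega S \<longrightarrow> P0 S (X0 S i z) = X0 S i z) \<and>
     (\<forall>i<npatch S. C1_on (Omega S) (chart S i)) \<and>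
     (\<forall>i<npatch S. \<forall>x\<in>Omega S. \<forall>y\<in>Omega S.
        1 / L * norm (x - y) \<le> norm (chart S i x - chart S i y) \<and>
        norm (chart S i x - chart S i y) \<le> L * norm (x - y))"


section \<open>Meshes\<close>

definition ref_verts :: "('d::finite, 'm::finite) surface \<Rightarrow> node \<Rightarrow> (real^'d) list" where
  "ref_verts S K = fst (foldl bisect_child (tag0 S (fst K)) (snd K))"

definition ref_elem :: "('d::finite, 'm::finite) surface \<Rightarrow> node \<Rightarrow> (real^'d) set" where
  "ref_elem S K = convex hull (set (ref_verts S K))"

definition flat_elem :: "('d::finite, 'm::finite) surface \<Rightarrow> node \<Rightarrow> (real^'m) set" where
  "flat_elem S K = X0 S (fst K) ` ref_elem S K"

definition mesh_size :: "('d::finite, 'm::finite) surface \<Rightarrow> node \<Rightarrow> real" where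
  "mesh_size S K = root CARD('d) (measure lebesgue (ref_elem S K))"

definition initial_mesh :: "('d::finite, 'm::finite) surface \<Rightarrow> node set" where
  "initial_mesh S = (\<lambda>i. (i, [])) ` {..<npatch S}"

definition meshes :: "('d::finite, 'm::finite) surface \<Rightarrow> node set set" where
  "meshes S = {A. refined_to (initial_mesh S) A \<and> triangulation (flat_elem S ` A)}"

text \<open>Faces are numbered by the opposite vertex.\<close>

definition ref_face :: "('d::finite, 'm::finite) surface \<Rightarrow> node \<Rightarrow> nat \<Rightarrow> (real^'d) set" where
  "ref_face S K k = convex hull (set (ref_verts S K) - {ref_verts S K ! k})"

definition flat_face :: "('d::finite, 'm::finite) surface \<Rightarrow> node \<Rightarrow> nat \<Rightarrow> (real^'m) set" where
  "flat_face S K k = X0 S (fst K) ` ref_face S K k"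

definition sides ::
    "('d::finite, 'm::finite) surface \<Rightarrow> node set \<Rightarrow> (real^'m) set \<Rightarrow> (node \<times> nat) set" where
  "sides S A F = {(K, k). K \<in> A \<and> k \<le> CARD('d) \<and> flat_face S K k = F}"

definition interior_face ::
    "('d::finite, 'm::finite) surface \<Rightarrow> node set \<Rightarrow> node \<Rightarrow> nat \<Rightarrow> bool" where
  "interior_face S A K k \<longleftrightarrow> (\<exists>(K', k') \<in> sides S A (flat_face S K k). K' \<noteq> K)"

definition interior_faces ::
    "('d::finite, 'm::finite) surface \<Rightarrow> node set \<Rightarrow> node \<Rightarrow> nat set" where
  "interior_faces S A K = {k. k \<le> CARD('d) \<and> interior_face S A K k}"

definition boundary_faces ::
    "('d::finite, 'm::finite) surface \<Rightarrow> node set \<Rightarrow> (node \<times> nat) set" where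
  "boundary_faces S A = {(K, k). K \<in> A \<and> k \<le> CARD('d) \<and> \<not> interior_face S A K k}"

definition exact_boundary :: "('d::finite, 'm::finite) surface \<Rightarrow> (real^'m) set" where
  "exact_boundary S = (\<Union>(K, k)\<in>boundary_faces S (initial_mesh S). chart S (fst K) ` ref_face S K k)"


section \<open>Discrete surface\<close>

definition lagrange_nodes :: "nat \<Rightarrow> (real^'d) list \<Rightarrow> (real^'d) set" where
  "lagrange_nodes n zs =
     {(\<Sum>j<length zs. (real (a j) / real n) *\<^sub>R (zs ! j)) | a. (\<Sum>j<length zs. a j) = n}"

text \<open>The interpolant lives on \<open>Omega\<close>; fixing the value \<open>0\<close> outside makes it a unique function.\<close>

definition lagrange_interp ::
    "('d::finite, 'm::finite) surface \<Rightarrow> nat \<Rightarrow> node set \<Rightarrow> nat \<Rightarrow>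
     (real^'d \<Rightarrow> real^'m) \<Rightarrow> real^'d \<Rightarrow> real^'m" where
  "lagrange_interp S n A i g = (THE X.
     (\<forall>x. x \<notin> Omega S \<longrightarrow> X x = 0) \<and>
     continuous_on (Omega S) X \<and>
     (\<forall>K\<in>A. fst K = i \<longrightarrow>
        (\<forall>c. \<exists>p\<in>poly_space n. \<forall>x\<in>ref_elem S K. X x $ c = p x) \<and>
        (\<forall>z\<in>lagrange_nodes n (ref_verts S K). X z = g z)))"

definition discrete_param ::
    "('d::finite, 'm::finite) surface \<Rightarrow> nat \<Rightarrow> node set \<Rightarrow> nat \<Rightarrow> real^'d \<Rightarrow> real^'m" where
  "discrete_param S n A i = lagrange_interp S n A i (chart S i)"

definition discrete_surface ::
    "('d::finite, 'm::finite) surface \<Rightarrow> nat \<Rightarrow> node set \<Rightarrow> (real^'m) set" where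
  "discrete_surface S n A = (\<Union>i<npatch S. discrete_param S n A i ` Omega S)"

definition discrete_boundary ::
    "('d::finite, 'm::finite) surface \<Rightarrow> nat \<Rightarrow> node set \<Rightarrow> (real^'m) set" where
  "discrete_boundary S n A =
     (\<Union>(K, k)\<in>boundary_faces S A. discrete_param S n A (fst K) ` ref_face S K k)"

definition chart_jac :: "('d::finite, 'm::finite) surface \<Rightarrow> nat \<Rightarrow> real^'d \<Rightarrow> real^'d^'m" where
  "chart_jac S i = jac_on (Omega S) (chart S i)"

definition elem_jac ::
    "('d::finite, 'm::finite) surface \<Rightarrow> nat \<Rightarrow> node set \<Rightarrow> node \<Rightarrow> real^'d \<Rightarrow> real^'d^'m" where
  "elem_jac S n A K = jac_on (ref_elem S K) (discrete_param S n A (fst K))"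

text \<open>Matrices are measured in the Euclidean operator norm.\<close>

definition geo_est_elem ::
    "('d::finite, 'm::finite) surface \<Rightarrow> nat \<Rightarrow> node set \<Rightarrow> node \<Rightarrow> real" where
  "geo_est_elem S n A K =
     enn2real (esssup (lebesgue_on (ref_elem S K))
       (\<lambda>x. ennreal (onorm ((*v) (chart_jac S (fst K) x - elem_jac S n A K x)))))"

definition geo_est :: "('d::finite, 'm::finite) surface \<Rightarrow> nat \<Rightarrow> node set \<Rightarrow> real" where
  "geo_est S n A = Max (geo_est_elem S n A ` A)"


section \<open>Continuous problem\<close>

text \<open>Functions on \<open>\<gamma>\<close> and on \<open>\<Gamma>\<close> are identified with their pullbacks to the copies of \<open>Omega\<close>.\<close>

definition pull_exact ::
    "('d::finite, 'm::finite) surface \<Rightarrow> (real^'m \<Rightarrow> real) \<Rightarrow> nat \<Rightarrow> real^'d \<Rightarrow> real" where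
  "pull_exact S v i x = v (chart S i x)"

definition pull_discrete ::
    "('d::finite, 'm::finite) surface \<Rightarrow> nat \<Rightarrow> node set \<Rightarrow>
     (real^'m \<Rightarrow> real) \<Rightarrow> nat \<Rightarrow> real^'d \<Rightarrow> real" where
  "pull_discrete S n A V i x = V (discrete_param S n A i x)"

definition int_exact ::
    "('d::finite, 'm::finite) surface \<Rightarrow> (nat \<Rightarrow> real^'d \<Rightarrow> real) \<Rightarrow> real" where
  "int_exact S w =
     (\<Sum>i<npatch S. LINT x|lebesgue_on (Omega S). w i x * area_el (chart_jac S i x))"

definition in_L2 ::
    "('d::finite, 'm::finite) surface \<Rightarrow> (nat \<Rightarrow> real^'d \<Rightarrow> real) \<Rightarrow> bool" where
  "in_L2 S w \<longleftrightarrow> (\<forall>i<npatch S.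
     w i \<in> borel_measurable (lebesgue_on (Omega S)) \<and>
     integrable (lebesgue_on (Omega S)) (\<lambda>x. (w i x)\<^sup>2 * area_el (chart_jac S i x)))"

definition exact_grad ::
    "('d::finite, 'm::finite) surface \<Rightarrow> (nat \<Rightarrow> real^'d \<Rightarrow> real) \<Rightarrow> nat \<Rightarrow> real^'d \<Rightarrow> real^'m" where
  "exact_grad S w i x = surf_grad (chart_jac S i x) (wgrad (Omega S) (w i) x)"

definition energy_norm ::
    "('d::finite, 'm::finite) surface \<Rightarrow> (nat \<Rightarrow> real^'d \<Rightarrow> real) \<Rightarrow> real" where
  "energy_norm S w = sqrt (int_exact S (\<lambda>i x. (norm (exact_grad S w i x))\<^sup>2))"

definition energy_dist ::
    "('d::finite, 'm::finite) surface \<Rightarrow> (nat \<Rightarrow> real^'d \<Rightarrow> real) \<Rightarrow>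
     (nat \<Rightarrow> real^'d \<Rightarrow> real) \<Rightarrow> real" where
  "energy_dist S v w = energy_norm S (\<lambda>i x. v i x - w i x)"

definition broken_H1 ::
    "('d::finite, 'm::finite) surface \<Rightarrow> (nat \<Rightarrow> real^'d \<Rightarrow> real) \<Rightarrow> bool" where
  "broken_H1 S w \<longleftrightarrow> in_L2 S w \<and> (\<forall>i<npatch S. \<exists>g. weak_gradient (Omega S) (w i) g \<and>
     integrable (lebesgue_on (Omega S)) (\<lambda>x. (norm (g x))\<^sup>2))"

definition H1_norm ::
    "('d::finite, 'm::finite) surface \<Rightarrow> (nat \<Rightarrow> real^'d \<Rightarrow> real) \<Rightarrow> real" where
  "H1_norm S w = sqrt (int_exact S (\<lambda>i x. (w i x)\<^sup>2) + (energy_norm S w)\<^sup>2)"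

definition H1_closure ::
    "('d::finite, 'm::finite) surface \<Rightarrow> (real^'m \<Rightarrow> real) set \<Rightarrow> (real^'m \<Rightarrow> real) set" where
  "H1_closure S D = {v. broken_H1 S (pull_exact S v) \<and>
     (\<exists>\<phi>. (\<forall>k::nat. \<phi> k \<in> D) \<and>
        (\<lambda>k. H1_norm S (\<lambda>i x. pull_exact S (\<phi> k) i x - pull_exact S v i x)) \<longlonglongrightarrow> 0)}"

definition lipschitz_functions ::
    "('d::finite, 'm::finite) surface \<Rightarrow> (real^'m \<Rightarrow> real) set" where
  "lipschitz_functions S = {\<phi>. \<exists>C. C-lipschitz_on (exact_surface S) \<phi>}"

text \<open>\<open>H\<^sup>1(\<gamma>)\<close> is the closure of the Lipschitz functions on the Lipschitz surface \<open>\<gamma>\<close>, and the subspace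
  of functions with zero trace is the closure of those vanishing on \<open>\<partial>\<gamma>\<close>.\<close>

definition H1_exact :: "('d::finite, 'm::finite) surface \<Rightarrow> (real^'m \<Rightarrow> real) set" where
  "H1_exact S = H1_closure S (lipschitz_functions S)"

definition H1_sharp :: "('d::finite, 'm::finite) surface \<Rightarrow> (real^'m \<Rightarrow> real) set" where
  "H1_sharp S =
     (if exact_boundary S = {} then {v \<in> H1_exact S. int_exact S (pull_exact S v) = 0}
      else H1_closure S {\<phi> \<in> lipschitz_functions S. \<forall>y\<in>exact_boundary S. \<phi> y = 0})"

definition admissible_rhs ::
    "('d::finite, 'm::finite) surface \<Rightarrow> (real^'m \<Rightarrow> real) \<Rightarrow> bool" where
  "admissible_rhs S f \<longleftrightarrow> in_L2 S (pull_exact S f) \<and>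
     (exact_boundary S = {} \<longrightarrow> int_exact S (pull_exact S f) = 0)"

definition weak_solution ::
    "('d::finite, 'm::finite) surface \<Rightarrow> (real^'m \<Rightarrow> real) \<Rightarrow> (real^'m \<Rightarrow> real) \<Rightarrow> bool" where
  "weak_solution S f u \<longleftrightarrow> u \<in> H1_sharp S \<and> (\<forall>\<phi>\<in>H1_sharp S.
     int_exact S (\<lambda>i x. exact_grad S (pull_exact S u) i x \<bullet> exact_grad S (pull_exact S \<phi>) i x) =
     int_exact S (\<lambda>i x. pull_exact S f i x * pull_exact S \<phi> i x))"


section \<open>Discrete problem\<close>

definition int_discrete ::
    "('d::finite, 'm::finite) surface \<Rightarrow> nat \<Rightarrow> node set \<Rightarrow> (node \<Rightarrow> real^'d \<Rightarrow> real) \<Rightarrow> real" where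
  "int_discrete S n A w =
     (\<Sum>K\<in>A. LINT x|lebesgue_on (ref_elem S K). w K x * area_el (elem_jac S n A K x))"

definition elem_grad ::
    "('d::finite, 'm::finite) surface \<Rightarrow> nat \<Rightarrow> node set \<Rightarrow>
     (real^'m \<Rightarrow> real) \<Rightarrow> node \<Rightarrow> real^'d \<Rightarrow> real^'d" where
  "elem_grad S n A V K = grad_on (ref_elem S K) (pull_discrete S n A V (fst K))"

definition discrete_grad ::
    "('d::finite, 'm::finite) surface \<Rightarrow> nat \<Rightarrow> node set \<Rightarrow>
     (real^'m \<Rightarrow> real) \<Rightarrow> node \<Rightarrow> real^'d \<Rightarrow> real^'m" where
  "discrete_grad S n A V K x = surf_grad (elem_jac S n A K x) (elem_grad S n A V K x)"

definition fe_space ::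
    "('d::finite, 'm::finite) surface \<Rightarrow> nat \<Rightarrow> node set \<Rightarrow> (real^'m \<Rightarrow> real) set" where
  "fe_space S n A = {V. continuous_on (discrete_surface S n A) V \<and>
     (\<forall>K\<in>A. \<exists>p\<in>poly_space n. \<forall>x\<in>ref_elem S K. pull_discrete S n A V (fst K) x = p x) \<and>
     (if discrete_boundary S n A = {}
      then int_discrete S n A (\<lambda>K. pull_discrete S n A V (fst K)) = 0
      else \<forall>y\<in>discrete_boundary S n A. V y = 0)}"

definition discrete_rhs ::
    "('d::finite, 'm::finite) surface \<Rightarrow> nat \<Rightarrow> (real^'m \<Rightarrow> real) \<Rightarrow> node set \<Rightarrow>
     node \<Rightarrow> real^'d \<Rightarrow> real" where
  "discrete_rhs S n f A K x = pull_exact S f (fst K) x *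
     area_el (chart_jac S (fst K) x) / area_el (elem_jac S n A K x)"

definition galerkin ::
    "('d::finite, 'm::finite) surface \<Rightarrow> nat \<Rightarrow> (real^'m \<Rightarrow> real) \<Rightarrow> node set \<Rightarrow>
     (real^'m \<Rightarrow> real) \<Rightarrow> bool" where
  "galerkin S n f A U \<longleftrightarrow> U \<in> fe_space S n A \<and> (\<forall>V\<in>fe_space S n A.
     int_discrete S n A (\<lambda>K x. discrete_grad S n A U K x \<bullet> discrete_grad S n A V K x) =
     int_discrete S n A (\<lambda>K x. discrete_rhs S n f A K x * pull_discrete S n A V (fst K) x))"


section \<open>Residual estimator and oscillation\<close>

definition ref_flux ::
    "('d::finite, 'm::finite) surface \<Rightarrow> nat \<Rightarrow> node set \<Rightarrow>
     (real^'m \<Rightarrow> real) \<Rightarrow> node \<Rightarrow> real^'d \<Rightarrow> real^'d" where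
  "ref_flux S n A V K x = area_el (elem_jac S n A K x) *\<^sub>R
     (elem_grad S n A V K x v* matrix_inv (metric (elem_jac S n A K x)))"

definition discrete_laplacian ::
    "('d::finite, 'm::finite) surface \<Rightarrow> nat \<Rightarrow> node set \<Rightarrow>
     (real^'m \<Rightarrow> real) \<Rightarrow> node \<Rightarrow> real^'d \<Rightarrow> real" where
  "discrete_laplacian S n A V K x =
     div_on (ref_elem S K) (ref_flux S n A V K) x / area_el (elem_jac S n A K x)"

definition ref_normal :: "('d::finite, 'm::finite) surface \<Rightarrow> node \<Rightarrow> nat \<Rightarrow> real^'d" where
  "ref_normal S K k = (THE \<nu>. norm \<nu> = 1 \<and>
     (\<forall>x\<in>ref_face S K k. \<forall>y\<in>ref_face S K k. \<nu> \<bullet> (x - y) = 0) \<and>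
     (\<forall>x\<in>ref_face S K k. 0 < \<nu> \<bullet> (x - ref_verts S K ! k)))"

text \<open>At the image of \<open>x\<close>, the tangent space of the element is the range of its Jacobian, and the
  tangent space of the face is the image of the orthogonal complement of the reference normal.\<close>

definition conormal ::
    "('d::finite, 'm::finite) surface \<Rightarrow> nat \<Rightarrow> node set \<Rightarrow> node \<Rightarrow> nat \<Rightarrow> real^'d \<Rightarrow> real^'m" where
  "conormal S n A K k x = (THE \<nu>. norm \<nu> = 1 \<and>
     (\<exists>w. \<nu> = elem_jac S n A K x *v w \<and> 0 < w \<bullet> ref_normal S K k) \<and>
     (\<forall>t. t \<bullet> ref_normal S K k = 0 \<longrightarrow> \<nu> \<bullet> (elem_jac S n A K x *v t) = 0))"

definition curved_face ::
    "('d::finite, 'm::finite) surface \<Rightarrow> nat \<Rightarrow> node set \<Rightarrow> node \<Rightarrow> nat \<Rightarrow> (real^'m) set" where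
  "curved_face S n A K k = discrete_param S n A (fst K) ` ref_face S K k"

text \<open>\<open>jump S n A V F\<close> is a function on the curved face corresponding to the flat interior face \<open>F\<close>,
  which has exactly two sides; \<open>ref_jump S n A V K k\<close> is a function on the face \<open>k\<close> of the reference
  element of \<open>K\<close>. Points of adjacent reference elements, possibly in different patches, are
  identified if they have the same image on the surface.\<close>

definition jump ::
    "('d::finite, 'm::finite) surface \<Rightarrow> nat \<Rightarrow> node set \<Rightarrow>
     (real^'m \<Rightarrow> real) \<Rightarrow> (real^'m) set \<Rightarrow> real^'m \<Rightarrow> real" where
  "jump S n A V F y = (\<Sum>(K, k)\<in>sides S A F.
     let x = inv_into (ref_face S K k) (discrete_param S n A (fst K)) y in
       discrete_grad S n A V K x \<bullet> conormal S n A K k x)"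

definition ref_jump ::
    "('d::finite, 'm::finite) surface \<Rightarrow> nat \<Rightarrow> node set \<Rightarrow>
     (real^'m \<Rightarrow> real) \<Rightarrow> node \<Rightarrow> nat \<Rightarrow> real^'d \<Rightarrow> real" where
  "ref_jump S n A V K k x = (\<Sum>(K', k')\<in>sides S A (flat_face S K k).
     let x' = inv_into (ref_face S K' k') (X0 S (fst K')) (X0 S (fst K) x) in
       ref_flux S n A V K' x' \<bullet> ref_normal S K' k')"

definition est_elem_sq ::
    "('d::finite, 'm::finite) surface \<Rightarrow> nat \<Rightarrow> (real^'m \<Rightarrow> real) \<Rightarrow> node set \<Rightarrow>
     (real^'m \<Rightarrow> real) \<Rightarrow> node \<Rightarrow> real" where
  "est_elem_sq S n f A V K =
     (mesh_size S K)\<^sup>2 * (LINT x|lebesgue_on (ref_elem S K).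
        (discrete_rhs S n f A K x + discrete_laplacian S n A V K x)\<^sup>2 * area_el (elem_jac S n A K x)) +
     mesh_size S K * (\<Sum>k\<in>interior_faces S A K.
        LINT y|restrict_space (hausdorff_measure (CARD('d) - 1)) (curved_face S n A K k).
          (jump S n A V (flat_face S K k) y)\<^sup>2)"

definition est ::
    "('d::finite, 'm::finite) surface \<Rightarrow> nat \<Rightarrow> (real^'m \<Rightarrow> real) \<Rightarrow> node set \<Rightarrow>
     (real^'m \<Rightarrow> real) \<Rightarrow> node set \<Rightarrow> real" where
  "est S n f A V \<tau> = sqrt (\<Sum>K\<in>\<tau>. est_elem_sq S n f A V K)"

definition L2_proj_err :: "(real^'d) measure \<Rightarrow> nat \<Rightarrow> (real^'d \<Rightarrow> real) \<Rightarrow> real" where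
  "L2_proj_err \<mu> m g = sqrt (LINT x|\<mu>. (g x - L2_proj \<mu> m g x)\<^sup>2)"

definition osc_elem_sq ::
    "('d::finite, 'm::finite) surface \<Rightarrow> nat \<Rightarrow> (real^'m \<Rightarrow> real) \<Rightarrow> node set \<Rightarrow>
     (real^'m \<Rightarrow> real) \<Rightarrow> node \<Rightarrow> real" where
  "osc_elem_sq S n f A V K =
     (mesh_size S K)\<^sup>2 * (L2_proj_err (lebesgue_on (ref_elem S K)) (2 * n - 2)
        (\<lambda>x. pull_exact S f (fst K) x * area_el (chart_jac S (fst K) x) +
             div_on (ref_elem S K) (ref_flux S n A V K) x))\<^sup>2 +
     mesh_size S K * (\<Sum>k\<in>interior_faces S A K.
        (L2_proj_err (restrict_space (hausdorff_measure (CARD('d) - 1)) (ref_face S K k)) (2 * n - 1)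
          (ref_jump S n A V K k))\<^sup>2)"

definition osc ::
    "('d::finite, 'm::finite) surface \<Rightarrow> nat \<Rightarrow> (real^'m \<Rightarrow> real) \<Rightarrow> node set \<Rightarrow>
     (real^'m \<Rightarrow> real) \<Rightarrow> node set \<Rightarrow> real" where
  "osc S n f A V \<tau> = sqrt (\<Sum>K\<in>\<tau>. osc_elem_sq S n f A V K)"


section \<open>Algorithms\<close>

text \<open>The modules are nondeterministic: \<open>module \<dots> input output\<close> holds for every admissible output.
  REFINE first bisects the elements of \<open>M\<close> only, obtaining a possibly nonconforming \<open>F\<close>, and then
  passes to a minimal conforming refinement of \<open>F\<close>.\<close>

definition refine_module ::
    "('d::finite, 'm::finite) surface \<Rightarrow> nat \<Rightarrow> node set \<Rightarrow> node set \<Rightarrow> node set \<Rightarrow> bool" where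
  "refine_module S b A M B \<longleftrightarrow> M \<subseteq> A \<and>
     (\<exists>F. refined_to A F \<and> A - M \<subseteq> F \<and> bisected_at_least b M F \<and>
        B \<in> meshes S \<and> refined_to F B \<and>
        (\<forall>B'\<in>meshes S. refined_to F B' \<and> refined_to B' B \<longrightarrow> B' = B))"

definition mark_module ::
    "('d::finite, 'm::finite) surface \<Rightarrow> nat \<Rightarrow> (real^'m \<Rightarrow> real) \<Rightarrow> real \<Rightarrow> node set \<Rightarrow>
     (real^'m \<Rightarrow> real) \<Rightarrow> node set \<Rightarrow> bool" where
  "mark_module S n f \<theta> A U M \<longleftrightarrow> M \<subseteq> A \<and> est S n f A U M \<ge> \<theta> * est S n f A U A"

definition surface_marked ::
    "('d::finite, 'm::finite) surface \<Rightarrow> nat \<Rightarrow> real \<Rightarrow> node set \<Rightarrow> node set" where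
  "surface_marked S n \<epsilon> A = {K \<in> A. geo_est_elem S n A K > \<epsilon>}"

definition adapt_surface ::
    "('d::finite, 'm::finite) surface \<Rightarrow> nat \<Rightarrow> nat \<Rightarrow> real \<Rightarrow> node set \<Rightarrow> node set \<Rightarrow> bool" where
  "adapt_surface S n b \<epsilon> A B \<longleftrightarrow>
     (\<lambda>T T'. surface_marked S n \<epsilon> T \<noteq> {} \<and> refine_module S b T (surface_marked S n \<epsilon> T) T')\<^sup>*\<^sup>* A B \<and>
     surface_marked S n \<epsilon> B = {}"

text \<open>\<open>adapt_pde_run S n b f \<theta> \<epsilon> A T U J\<close>: the call with input mesh \<open>A\<close> and tolerance \<open>\<epsilon>\<close> produces the
  meshes \<open>T j\<close> and Galerkin solutions \<open>U j\<close> for \<open>j \<le> J\<close>, where \<open>J = \<infinity>\<close> if the loop does not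
  terminate.\<close>

definition adapt_pde_run ::
    "('d::finite, 'm::finite) surface \<Rightarrow> nat \<Rightarrow> nat \<Rightarrow> (real^'m \<Rightarrow> real) \<Rightarrow> real \<Rightarrow> real \<Rightarrow> node set \<Rightarrow>
     (nat \<Rightarrow> node set) \<Rightarrow> (nat \<Rightarrow> real^'m \<Rightarrow> real) \<Rightarrow> enat \<Rightarrow> bool" where
  "adapt_pde_run S n b f \<theta> \<epsilon> A T U J \<longleftrightarrow>
     T 0 = A \<and>
     (\<forall>j. enat j \<le> J \<longrightarrow> galerkin S n f (T j) (U j)) \<and>
     (\<forall>j. enat j < J \<longrightarrow> \<epsilon> \<le> est S n f (T j) (U j) (T j) \<and>
        (\<exists>M. mark_module S n f \<theta> (T j) (U j) M \<and> refine_module S b (T j) M (T (Suc j)))) \<and>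
     (\<forall>j. J = enat j \<longrightarrow> est S n f (T j) (U j) (T j) < \<epsilon>)"

text \<open>An execution of AFEM that enters the calls \<open>k < N\<close> of ADAPT_PDE. The outer meshes are \<open>Tk k\<close> and
  \<open>Tp k\<close> (before and after ADAPT_SURFACE); the inner iterates of call \<open>k\<close> are \<open>T k j\<close>, \<open>U k j\<close> for
  \<open>j \<le> J k\<close>. The next outer step is reached only if the call terminates.\<close>

definition afem_run ::
    "('d::finite, 'm::finite) surface \<Rightarrow> nat \<Rightarrow> nat \<Rightarrow> (real^'m \<Rightarrow> real) \<Rightarrow> real \<Rightarrow>
     real \<Rightarrow> real \<Rightarrow> real \<Rightarrow> enat \<Rightarrow> (nat \<Rightarrow> node set) \<Rightarrow> (nat \<Rightarrow> node set) \<Rightarrow>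
     (nat \<Rightarrow> nat \<Rightarrow> node set) \<Rightarrow> (nat \<Rightarrow> nat \<Rightarrow> real^'m \<Rightarrow> real) \<Rightarrow> (nat \<Rightarrow> enat) \<Rightarrow> bool" where
  "afem_run S n b f \<theta> \<omega> \<epsilon>0 \<rho> N Tk Tp T U J \<longleftrightarrow>
     Tk 0 = initial_mesh S \<and>
     (\<forall>k. enat k < N \<longrightarrow>
        adapt_surface S n b (\<omega> * (\<epsilon>0 * \<rho> ^ k)) (Tk k) (Tp k) \<and>
        adapt_pde_run S n b f \<theta> (\<epsilon>0 * \<rho> ^ k) (Tp k) (T k) (U k) (J k) \<and>
        (enat (Suc k) < N \<longrightarrow> (\<exists>j. J k = enat j \<and> Tk (Suc k) = T k j)))"

end

theory Submission
  imports Defs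
begin

text \<open>Inside ADAPT_PDE the geometric error is dominated by the estimator: quasi-monotonicity gives
  \<open>\<lambda> \<le> \<Lambda>0 \<omega> \<epsilon>\<close>, and \<open>\<epsilon> \<le> \<eta>\<close> as long as the loop continues. Adding \<open>\<beta>\<close> times the estimator reduction to
  the quasi-orthogonality, the distance of the two Galerkin solutions cancels, the geometric terms are
  absorbed by the reduction of the estimator, and the upper bound of the error by the estimator turns
  the remaining gain into a contraction. The number of iterations is bounded because the total error
  at the start of each call is at most a fixed multiple of \<open>\<epsilon>\<^sup>2\<close>, while it stays above \<open>\<beta> \<epsilon>\<^sup>2\<close>
  as long as the loop continues.\<close>

section \<open>Bisection forests\<close>

lemma bisection_finite: "bisection A B \<Longrightarrow> finite A \<Longrightarrow> finite B"
  by (auto elim: bisection.cases)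

lemma refined_to_finite: "refined_to A B \<Longrightarrow> finite A \<Longrightarrow> finite B"
  by (induction rule: rtranclp_induct) (auto intro: bisection_finite)

lemma refined_to_nonempty: "refined_to A B \<Longrightarrow> A \<noteq> {} \<Longrightarrow> B \<noteq> {}"
  by (induction rule: rtranclp_induct) (auto elim: bisection.cases)

lemma descendant_refl [simp]: "descendant K K"
  by (simp add: descendant_def)

lemma descendant_trans: "descendant K K' \<Longrightarrow> descendant K' K'' \<Longrightarrow> descendant K K''"
  by (auto simp: descendant_def)

lemma descendant_comparable:
  "descendant K K'' \<Longrightarrow> descendant K' K'' \<Longrightarrow> descendant K K' \<or> descendant K' K"
  by (auto simp: descendant_def dest: prefix_same_cases)

text \<open>A bisection replaces an element only by nodes below it, so following parents back
  through the steps leads to \<open>A\<close>.\<close>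

lemma refined_to_ancestor:
  assumes "refined_to A B" "K' \<in> B"
  shows "\<exists>K\<in>A. descendant K K'"
  using assms
proof (induction arbitrary: K' rule: rtranclp_induct)
  case base
  then show ?case by (auto simp: descendant_def)
next
  case (step B D)
  from step.hyps(2) obtain i p where ip: "(i, p) \<in> B"
    and D: "D = B - {(i, p)} \<union> {(i, p @ [False]), (i, p @ [True])}"
    by (auto elim: bisection.cases)
  have "\<exists>K''\<in>B. descendant K'' K'"
  proof (cases "K' \<in> B")
    case False
    then show ?thesis
      using ip step.prems unfolding D by (auto simp: descendant_def intro!: bexI[of _ "(i, p)"])
  next
    case True
    then show ?thesis
      using descendant_refl by blast
  qed
  then show ?case
    using step.IH descendant_trans by blast
qed

text \<open>Combinatorial stand-in for elements that do not overlap: it makes the ancestor of a node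
  in a mesh unique without any geometry.\<close>

definition antichain :: "node set \<Rightarrow> bool" where
  "antichain A \<longleftrightarrow> (\<forall>K\<in>A. \<forall>K'\<in>A. descendant K K' \<longrightarrow> K = K')"

text \<open>A node of \<open>A\<close> comparable with a child of \<open>(i, p)\<close> is already
  comparable with \<open>(i, p)\<close>, and neither child is a prefix of the other.\<close>

lemma bisection_antichain:
  assumes "bisection A B" "antichain A"
  shows "antichain B"
proof -
  from assms(1) obtain i p where ip: "(i, p) \<in> A"
    and B: "B = A - {(i, p)} \<union> {(i, p @ [False]), (i, p @ [True])}"
    by (auto elim: bisection.cases)
  have up: False if "K \<in> A" "K \<noteq> (i, p)" "descendant K (i, p @ [c])" for K c
    using that ip assms(2) unfolding antichain_def descendant_def
    by (metis fst_conv prefix_append prefix_order.order_refl prefix_snoc snd_conv prod.collapse)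
  have down: False if "K \<in> A" "K \<noteq> (i, p)" "descendant (i, p @ [c]) K" for K c
    using that ip assms(2) unfolding antichain_def descendant_def
    by (metis append_prefixD fst_conv snd_conv)
  show ?thesis
    unfolding antichain_def
  proof (intro ballI impI)
    fix K K'
    assume "K \<in> B" "K' \<in> B" and KK: "descendant K K'"
    then consider "K \<in> A" "K' \<in> A" | c where "K = (i, p @ [c])" "K' \<in> A" "K' \<noteq> (i, p)"
      | c where "K' = (i, p @ [c])" "K \<in> A" "K \<noteq> (i, p)"
      | c c' where "K = (i, p @ [c])" "K' = (i, p @ [c'])"
      unfolding B by blast
    then show "K = K'"
    proof cases
      case 1
      then show ?thesis using assms(2) KK by (auto simp: antichain_def)
    next
      case 2
      then show ?thesis using down KK by blast
    next
      case 3
      then show ?thesis using up KK by blast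
    next
      case 4
      then show ?thesis using KK by (auto simp: descendant_def)
    qed
  qed
qed

lemma refined_to_antichain: "refined_to A B \<Longrightarrow> antichain A \<Longrightarrow> antichain B"
  by (induction rule: rtranclp_induct) (auto intro: bisection_antichain)

text \<open>REFINE grants the number of bisections for \<open>F\<close>, before the passage to a
  conforming mesh. The element of \<open>F\<close> above \<open>K'\<close> must lie below
  \<open>K\<close>: otherwise its ancestor in the antichain \<open>A\<close> is above
  \<open>K\<close>, hence equal to \<open>K\<close>.\<close>

lemma bisected_at_least_mono:
  assumes "antichain A" "M \<subseteq> A" "refined_to A F" "bisected_at_least b M F" "refined_to F B"
  shows "bisected_at_least b M B"
  unfolding bisected_at_least_def
proof (intro ballI impI)
  fix K K'
  assume K: "K \<in> M" "K' \<in> B" "descendant K K'"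
  obtain K'' where K'': "K'' \<in> F" "descendant K'' K'"
    using refined_to_ancestor assms(5) K(2) by blast
  obtain K0 where K0: "K0 \<in> A" "descendant K0 K''"
    using refined_to_ancestor assms(3) K''(1) by blast
  have "descendant K K''"
  proof (rule ccontr)
    assume n: "\<not> descendant K K''"
    then have "descendant K'' K"
      using descendant_comparable K(3) K''(2) by blast
    then have "K0 = K"
      using K0 K(1) assms(1,2) descendant_trans unfolding antichain_def by blast
    then show False
      using n K0(2) by simp
  qed
  then have "length (snd K) + b \<le> length (snd K'')"
    using assms(4) K(1) K''(1) by (auto simp: bisected_at_least_def)
  also have "\<dots> \<le> length (snd K')"
    using K''(2) by (auto simp: descendant_def prefix_length_le)
  finally show "length (snd K) + b \<le> length (snd K')" .
qed

section \<open>Meshes\<close>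

text \<open>The initial tags list the extreme points of \<open>Omega S\<close>, so by Krein-Milman
  the elements with empty address are the whole faces.\<close>

lemma initial_mesh_in_meshes:
  fixes S :: "('d::finite, 'm::finite) surface"
  assumes "param_surface S L"
  shows "initial_mesh S \<in> meshes S"
proof -
  have Om: "compact (Omega S)" "convex (Omega S)"
    and ext: "\<forall>i<npatch S. set (fst (tag0 S i)) = {z. z extreme_point_of Omega S}"
    and tri: "triangulation ((\<lambda>i. X0 S i ` Omega S) ` {..<npatch S})"
    using assms compact_simplex convex_simplex unfolding param_surface_def by blast+
  have "flat_elem S (i, []) = X0 S i ` Omega S" if "i < npatch S" for i
    unfolding flat_elem_def ref_elem_def ref_verts_def
    using Krein_Milman_Minkowski[OF Om] ext that by simp
  then have "flat_elem S ` initial_mesh S = (\<lambda>i. X0 S i ` Omega S) ` {..<npatch S}"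
    unfolding initial_mesh_def image_image by (intro image_cong) simp_all
  then show ?thesis
    using tri by (simp only: meshes_def mem_Collect_eq rtranclp.rtrancl_refl simp_thms)
qed

lemma mesh_finite: "A \<in> meshes S \<Longrightarrow> finite A"
  using refined_to_finite by (auto simp: meshes_def initial_mesh_def)

lemma mesh_nonempty:
  assumes "param_surface S L" "A \<in> meshes S"
  shows "A \<noteq> {}"
proof -
  have "initial_mesh S \<noteq> {}"
    using assms(1) unfolding param_surface_def
    by (simp only: initial_mesh_def image_is_empty lessThan_empty_iff) simp
  then show ?thesis
    using assms(2) refined_to_nonempty by (auto simp: meshes_def)
qed

lemma mesh_antichain:
  assumes "A \<in> meshes S"
  shows "antichain A"
proof (rule refined_to_antichain)
  show "refined_to (initial_mesh S) A"
    using assms by (simp add: meshes_def)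
  show "antichain (initial_mesh S)"
    by (auto simp: antichain_def initial_mesh_def descendant_def)
qed

lemma refine_module_mesh:
  assumes "refine_module S b A M B"
  shows "B \<in> meshes S" "refined_to A B"
  using assms by (auto simp: refine_module_def)

lemma refine_module_bisected:
  assumes "refine_module S b A M B" "A \<in> meshes S"
  shows "M \<subseteq> A" "bisected_at_least b M B"
proof -
  obtain F where F: "M \<subseteq> A" "refined_to A F" "bisected_at_least b M F" "refined_to F B"
    using assms(1) by (auto simp: refine_module_def)
  show "M \<subseteq> A"
    by (rule F(1))
  show "bisected_at_least b M B"
    using bisected_at_least_mono mesh_antichain[OF assms(2)] F by blast
qed

lemma adapt_surface_mesh:
  assumes "adapt_surface S n b \<epsilon> A B" "A \<in> meshes S"
  shows "B \<in> meshes S \<and> refined_to A B"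
proof -
  have "(\<lambda>T T'. surface_marked S n \<epsilon> T \<noteq> {} \<and>
           refine_module S b T (surface_marked S n \<epsilon> T) T')\<^sup>*\<^sup>* A B"
    using assms(1) by (simp add: adapt_surface_def)
  then show ?thesis
    using assms(2)
    by (induction rule: rtranclp_induct) (auto dest: refine_module_mesh intro: rtranclp_trans)
qed

lemma adapt_pde_run_mesh:
  assumes "adapt_pde_run S n b f \<theta> \<epsilon> A T U J" "A \<in> meshes S" "enat j \<le> J"
  shows "T j \<in> meshes S \<and> refined_to A (T j)"
  using assms(3)
proof (induction j)
  case 0
  then show ?case
    using assms by (simp add: adapt_pde_run_def)
next
  case (Suc j)
  then have "enat j < J"
    using Suc_ile_eq by blast
  then obtain M where "refine_module S b (T j) M (T (Suc j))"
    using assms(1) unfolding adapt_pde_run_def by blast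
  then show ?case
    using Suc.IH \<open>enat j < J\<close> refine_module_mesh
    by (metis order_less_imp_le rtranclp_trans)
qed

text \<open>\<open>Max\<close> is meaningful only on finite nonempty sets; this is what
  \<open>mesh_finite\<close> and \<open>mesh_nonempty\<close> are for.\<close>

lemma geo_est_nonneg:
  assumes "finite A" "A \<noteq> {}"
  shows "0 \<le> geo_est S n A"
proof -
  have "geo_est S n A \<in> geo_est_elem S n A ` A"
    unfolding geo_est_def using assms by (intro Max_in) auto
  then show ?thesis
    by (auto simp: geo_est_elem_def)
qed

lemma adapt_surface_geo_est:
  assumes "adapt_surface S n b \<epsilon> A B" "finite B" "B \<noteq> {}"
  shows "geo_est S n B \<le> \<epsilon>"
  using assms unfolding geo_est_def adapt_surface_def surface_marked_def
  by (subst Max_le_iff) (auto simp: not_less[symmetric])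

section \<open>Nonnegativity of the estimator\<close>

text \<open>The segment from the identity to a positive semidefinite matrix consists, up to the endpoint,
  of nonsingular matrices, so the determinant cannot change sign along it.\<close>

lemma det_metric_nonneg: "0 \<le> det (metric (J :: real^'d^'m))"
proof (rule ccontr)
  assume neg: "\<not> 0 \<le> det (metric J)"
  define A :: "real \<Rightarrow> real^'d^'d" where
    "A t = t *\<^sub>R mat 1 + (1 - t) *\<^sub>R metric J" for t
  have "continuous_on {0..1} (\<lambda>t. det (A t))"
    unfolding A_def det_def by (intro continuous_intros)
  moreover have "det (A 0) \<le> 0" "0 \<le> det (A 1)"
    using neg by (auto simp: A_def)
  ultimately obtain t where t: "0 \<le> t" "t \<le> 1" "det (A t) = 0"
    using IVT'[of "\<lambda>t. det (A t)" 0 0 1] by auto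
  have "t \<noteq> 0"
    using t neg by (auto simp: A_def)
  from t(3) obtain x where x: "x \<noteq> 0" "A t *v x = 0"
    using invertible_det_nz[of "A t"] invertible_left_inverse[of "A t"]
      matrix_left_invertible_ker[of "A t"] by auto
  \<comment> \<open>As \<open>metric J\<close> is a Gram matrix and \<open>t > 0\<close>, the
    quadratic form of \<open>A t\<close> is positive at the kernel vector \<open>x\<close>.\<close>
  have "x \<bullet> (metric J *v x) = (J *v x) \<bullet> (J *v x)"
    by (simp add: metric_def matrix_vector_mul_assoc[symmetric] dot_lmul_matrix[symmetric]
        vector_transpose_matrix inner_commute)
  then have "x \<bullet> (A t *v x) = t * (x \<bullet> x) + (1 - t) * ((J *v x) \<bullet> (J *v x))"
    by (simp add: A_def matrix_vector_mult_add_rdistrib scaleR_matrix_vector_assoc[symmetric]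
        inner_add_right)
  moreover have "0 < t * (x \<bullet> x)"
    using t \<open>t \<noteq> 0\<close> x(1) by simp
  moreover have "0 \<le> (1 - t) * ((J *v x) \<bullet> (J *v x))"
    using t by simp
  ultimately show False
    using x(2) by simp
qed

text \<open>In HOL \<open>sqrt\<close> is negative on negative numbers, so the sign of the area
  element rests on \<open>det_metric_nonneg\<close>.\<close>

lemma est_elem_sq_nonneg: "0 \<le> est_elem_sq S n f A V K"
  unfolding est_elem_sq_def area_el_def mesh_size_def
  by (intro add_nonneg_nonneg mult_nonneg_nonneg Bochner_Integration.integral_nonneg sum_nonneg)
    (auto intro: det_metric_nonneg)

lemma est_nonneg: "0 \<le> est S n f A V \<tau>"
  unfolding est_def by (intro real_sqrt_ge_zero sum_nonneg est_elem_sq_nonneg)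

section \<open>Contraction and perturbation of the total error\<close>

text \<open>In the next two lemmas the variables stand for the squares of the energy errors \<open>e\<close>, \<open>e'\<close>, of
  the distance \<open>E\<close> of the Galerkin solutions, of the estimators \<open>h\<close>, \<open>h'\<close> and of the geometric
  estimator \<open>l\<close>. The parameter \<open>\<delta>\<close> solves \<open>(1 + \<delta>) (1 - s) = 1 - s / 2\<close>, and \<open>\<beta>\<close> makes the terms with
  \<open>E\<close> cancel.\<close>

lemma total_error_contraction:
  fixes e e' E h h' l s C \<Lambda>2 \<Lambda>3 :: real
  defines "\<delta> \<equiv> s / (2 * (1 - s))" and "\<beta> \<equiv> s / (2 * \<Lambda>3 * (2 - s))"
  assumes s: "0 < s" "s < 1" and pos: "0 < C" "0 < \<Lambda>2" "0 < \<Lambda>3" and "0 \<le> h"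
    and orth: "e' \<le> e - 1 / 2 * E + \<Lambda>2 * l"
    and red: "h' \<le> (1 + \<delta>) * ((1 - s) * h) + (1 + 1 / \<delta>) * (\<Lambda>3 * E + \<Lambda>2 * l)"
    and l: "l \<le> s\<^sup>2 / (32 * \<Lambda>2 * (2 * \<Lambda>3 + 1)) * h"
    and e: "e \<le> C * h"
  shows "e' + \<beta> * h' \<le> (1 - 7 * s * \<beta> / (16 * (C + \<beta>))) * (e + \<beta> * h)"
proof -
  have \<beta>: "0 < \<beta>"
    using s pos by (simp add: \<beta>_def)
  have d1: "(1 + \<delta>) * (1 - s) = 1 - s / 2"
    using s by (simp add: \<delta>_def field_simps)
  \<comment> \<open>Multiplied by \<open>\<Lambda>3 * E\<close>, this is the
    \<open>1 / 2 * E\<close> that \<open>orth\<close> subtracts.\<close>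
  have d2: "\<beta> * (1 + 1 / \<delta>) = 1 / (2 * \<Lambda>3)"
  proof -
    have "1 + 1 / \<delta> = (2 - s) / s"
      using s by (simp add: \<delta>_def field_simps)
    then show ?thesis
      using s pos by (simp add: \<beta>_def)
  qed
  have "\<beta> * h' \<le> \<beta> * ((1 + \<delta>) * ((1 - s) * h) + (1 + 1 / \<delta>) * (\<Lambda>3 * E + \<Lambda>2 * l))"
    using red \<beta> by simp
  also have "\<dots> = \<beta> * (((1 + \<delta>) * (1 - s)) * h) + (\<beta> * (1 + 1 / \<delta>)) * (\<Lambda>3 * E + \<Lambda>2 * l)"
    by (simp only: distrib_left[of \<beta> "(1 + \<delta>) * ((1 - s) * h)"] mult.assoc)
  also have "\<dots> = \<beta> * ((1 - s / 2) * h) + 1 / 2 * E + \<Lambda>2 / (2 * \<Lambda>3) * l"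
    unfolding d1 d2 using pos by (simp add: field_simps)
  finally have "e' + \<beta> * h' \<le> e + \<beta> * ((1 - s / 2) * h) + (\<Lambda>2 + \<Lambda>2 / (2 * \<Lambda>3)) * l"
    using orth by (simp add: distrib_right)
  also have "(\<Lambda>2 + \<Lambda>2 / (2 * \<Lambda>3)) * l
      \<le> (\<Lambda>2 + \<Lambda>2 / (2 * \<Lambda>3)) * (s\<^sup>2 / (32 * \<Lambda>2 * (2 * \<Lambda>3 + 1)) * h)"
    using l pos by (intro mult_left_mono) auto
  also have "\<dots> = s\<^sup>2 / (64 * \<Lambda>3) * h"
  proof -
    have "\<Lambda>2 + \<Lambda>2 / (2 * \<Lambda>3) = \<Lambda>2 * (2 * \<Lambda>3 + 1) / (2 * \<Lambda>3)"
      using pos by (simp add: field_simps)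
    then show ?thesis
      using pos by simp
  qed
  \<comment> \<open>The geometric terms use up at most an eighth of the gain
    \<open>\<beta> * s / 2 * h\<close>, which leaves the factor 7/16.\<close>
  also have "\<dots> \<le> \<beta> * (s / 16) * h"
  proof (rule mult_right_mono)
    have "s\<^sup>2 / (64 * \<Lambda>3) = s\<^sup>2 / (32 * \<Lambda>3 * 2)"
      by simp
    also have "\<dots> \<le> s\<^sup>2 / (32 * \<Lambda>3 * (2 - s))"
      using s pos by (intro divide_left_mono mult_left_mono) auto
    also have "\<dots> = \<beta> * (s / 16)"
      by (simp add: \<beta>_def power2_eq_square)
    finally show "s\<^sup>2 / (64 * \<Lambda>3) \<le> \<beta> * (s / 16)" .
  qed (rule \<open>0 \<le> h\<close>)
  finally have main: "e' + \<beta> * h' \<le> e + \<beta> * h - 7 * s * \<beta> / 16 * h"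
    by (simp add: algebra_simps)
  \<comment> \<open>The gain is so far a multiple of \<open>h\<close> alone; as
    \<open>e \<le> C * h\<close>, it dominates a multiple of the total error.\<close>
  have "7 * s * \<beta> / (16 * (C + \<beta>)) * (e + \<beta> * h)
      \<le> 7 * s * \<beta> / (16 * (C + \<beta>)) * ((C + \<beta>) * h)"
    using e s \<beta> pos by (intro mult_left_mono) (auto simp: distrib_right)
  also have "\<dots> = 7 * s * \<beta> / 16 * h"
  proof -
    have "C + \<beta> \<noteq> 0"
      using \<beta> pos by simp
    then show ?thesis
      by (simp add: divide_simps)
  qed
  finally show ?thesis
    using main by (simp add: left_diff_distrib)
qed

text \<open>Without marking there is no contraction, but the total error after any refinement is
  still controlled by the estimators before it. This bounds the first iterate of a call.\<close>

lemma total_error_perturbation: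
  fixes e e' E h h' l \<beta> C1 \<Lambda>1 \<Lambda>2 \<Lambda>3 :: real
  assumes pos: "0 \<le> \<beta>" "0 \<le> C1" "0 \<le> \<Lambda>1" "0 \<le> \<Lambda>2" "0 \<le> \<Lambda>3" and "0 \<le> h" "0 \<le> l" "0 \<le> e'"
    and orth: "e' \<le> e - 1 / 2 * E + \<Lambda>2 * l"
    and red: "h' \<le> 2 * h + 2 * (\<Lambda>3 * E + \<Lambda>2 * l)"
    and e: "e \<le> C1 * h + \<Lambda>1 * l"
    and "0 \<le> E"
  shows "e' + \<beta> * h' \<le> (C1 + \<Lambda>1 + \<Lambda>2 + 2 * \<beta> * (1 + \<Lambda>2 + 2 * \<Lambda>3 * (C1 + \<Lambda>1 + \<Lambda>2))) * (h + l)"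
proof -
  define D where "D = C1 + \<Lambda>1 + \<Lambda>2"
  have D: "e + \<Lambda>2 * l \<le> D * (h + l)"
    using e mult_nonneg_nonneg[OF pos(2) \<open>0 \<le> l\<close>] mult_nonneg_nonneg[OF pos(3) \<open>0 \<le> h\<close>]
      mult_nonneg_nonneg[OF pos(4) \<open>0 \<le> h\<close>]
    by (simp add: D_def algebra_simps)
  have e': "e' \<le> D * (h + l)"
    using orth D \<open>0 \<le> E\<close> by linarith
  \<comment> \<open>Quasi-orthogonality read backwards: as \<open>e'\<close> is nonnegative, it
    bounds \<open>E\<close>.\<close>
  have "E \<le> 2 * (D * (h + l))"
    using orth D \<open>0 \<le> e'\<close> by linarith
  then have "\<Lambda>3 * E \<le> \<Lambda>3 * (2 * (D * (h + l)))"
    using pos by (intro mult_left_mono) auto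
  moreover have "h + \<Lambda>2 * l \<le> (1 + \<Lambda>2) * (h + l)"
    using \<open>0 \<le> l\<close> mult_nonneg_nonneg[OF pos(4) \<open>0 \<le> h\<close>] by (simp add: algebra_simps)
  ultimately have "h' \<le> 2 * (1 + \<Lambda>2 + 2 * \<Lambda>3 * D) * (h + l)"
    using red by (simp add: algebra_simps)
  then have "\<beta> * h' \<le> \<beta> * (2 * (1 + \<Lambda>2 + 2 * \<Lambda>3 * D) * (h + l))"
    using pos by (intro mult_left_mono) auto
  then show ?thesis
    using e' unfolding D_def[symmetric] by (simp add: algebra_simps)
qed

text \<open>Turns contraction into an iteration count: \<open>m\<close> depends only on the factor,
  the initial bound and the threshold.\<close>

lemma geometric_decay_bounded:
  fixes q B c :: real
  assumes "0 < q" "q < 1" "0 < c"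
  shows "\<exists>m. \<forall>j. c \<le> q ^ j * B \<longrightarrow> j < m"
proof -
  have "(\<lambda>j. q ^ j * B) \<longlonglongrightarrow> 0"
    using assms by (auto intro!: tendsto_mult_left_zero LIMSEQ_realpow_zero)
  then have "eventually (\<lambda>j. q ^ j * B < c) sequentially"
    using assms(3) by (rule order_tendstoD)
  then show ?thesis
    unfolding eventually_sequentially by (meson not_le)
qed

section \<open>Runs of AFEM and the main estimate\<close>

lemma afem_run_outer_mesh:
  assumes run: "afem_run S n b f \<theta> \<omega> \<epsilon>0 \<rho> N Tk Tp T U J" and S: "param_surface S L"
    and k: "enat k < N"
  shows "Tk k \<in> meshes S \<and> Tp k \<in> meshes S \<and> refined_to (Tk k) (Tp k)"
  using k
proof (induction k)
  case 0
  have "Tk 0 \<in> meshes S"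
    using run initial_mesh_in_meshes[OF S] by (simp add: afem_run_def)
  moreover have "adapt_surface S n b (\<omega> * (\<epsilon>0 * \<rho> ^ 0)) (Tk 0) (Tp 0)"
    using run 0 unfolding afem_run_def by blast
  ultimately show ?case
    using adapt_surface_mesh by blast
next
  case (Suc k)
  then have k: "enat k < N"
    by (meson enat_ord_simps(2) lessI less_trans)
  have pde: "adapt_pde_run S n b f \<theta> (\<epsilon>0 * \<rho> ^ k) (Tp k) (T k) (U k) (J k)"
    using run k unfolding afem_run_def by blast
  \<comment> \<open>Call \<open>Suc k\<close> is entered only if call \<open>k\<close> terminated,
    so \<open>J k\<close> is finite.\<close>
  obtain j where "J k = enat j" "Tk (Suc k) = T k j"
    using run k Suc.prems unfolding afem_run_def by blast
  then have "Tk (Suc k) \<in> meshes S"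
    using adapt_pde_run_mesh[OF pde, of j] Suc.IH[OF k] by simp
  moreover have "adapt_surface S n b (\<omega> * (\<epsilon>0 * \<rho> ^ Suc k)) (Tk (Suc k)) (Tp (Suc k))"
    using run Suc.prems unfolding afem_run_def by blast
  ultimately show ?case
    using adapt_surface_mesh by blast
qed

text \<open>\<open>\<alpha>\<close> and \<open>\<beta>\<close> are chosen before the tolerances and
  the run. \<open>Jmax\<close> may depend on \<open>\<epsilon>0\<close>, \<open>\<rho>\<close> and
  the first input mesh \<open>A0\<close>, but not on \<open>k\<close> or on the nondeterministic
  choices made after \<open>A0\<close>. As \<open>J k\<close> is an \<open>enat\<close>, its bound
  includes termination of every call.\<close>

theorem theorem6p2:
  fixes S :: "('d::finite, 'm::finite) surface"
    and n b :: nat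
    and f u :: "real^'m \<Rightarrow> real"
    and L C1 C2 \<Lambda>0 \<Lambda>1 \<Lambda>2 \<Lambda>3 \<theta> \<omega> \<xi> :: real
  assumes surface: "param_surface S L" and "1 \<le> L"
    and "1 \<le> n" and "1 \<le> b"
    and "admissible_rhs S f"
    and "weak_solution S f u"
    and xi: "\<xi> = 1 - 2 powr (- (real b / real CARD('d)))"
    and pos: "0 < C1" "0 < C2" "1 < \<Lambda>0" "0 < \<Lambda>1" "0 < \<Lambda>2" "0 < \<Lambda>3"
    and quasi_mono: "\<And>A B. A \<in> meshes S \<Longrightarrow> B \<in> meshes S \<Longrightarrow> refined_to A B \<Longrightarrow>
          geo_est S n B \<le> \<Lambda>0 * geo_est S n A"
    and quasi_mono_elem: "\<And>A B K K'. A \<in> meshes S \<Longrightarrow> B \<in> meshes S \<Longrightarrow> refined_to A B \<Longrightarrow>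
          K \<in> A \<Longrightarrow> K' \<in> B \<Longrightarrow> descendant K K' \<Longrightarrow>
          geo_est_elem S n B K' \<le> \<Lambda>0 * geo_est_elem S n A K"
    and upper: "\<And>A U. A \<in> meshes S \<Longrightarrow> galerkin S n f A U \<Longrightarrow>
          (energy_dist S (pull_exact S u) (pull_discrete S n A U))\<^sup>2
          \<le> C1 * (est S n f A U A)\<^sup>2 + \<Lambda>1 * (geo_est S n A)\<^sup>2"
    and lower: "\<And>A U. A \<in> meshes S \<Longrightarrow> galerkin S n f A U \<Longrightarrow>
          C2 * (est S n f A U A)\<^sup>2
          \<le> (energy_dist S (pull_exact S u) (pull_discrete S n A U))\<^sup>2
            + (osc S n f A U A)\<^sup>2 + \<Lambda>1 * (geo_est S n A)\<^sup>2"
    and reduction: "\<And>A B U U' M \<delta>. A \<in> meshes S \<Longrightarrow> B \<in> meshes S \<Longrightarrow> refined_to A B \<Longrightarrow>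
          galerkin S n f A U \<Longrightarrow> galerkin S n f B U' \<Longrightarrow>
          M \<subseteq> A \<Longrightarrow> bisected_at_least b M B \<Longrightarrow> 0 < \<delta> \<Longrightarrow>
          (est S n f B U' B)\<^sup>2
          \<le> (1 + \<delta>) * ((est S n f A U A)\<^sup>2 - \<xi> * (est S n f A U M)\<^sup>2)
            + (1 + 1 / \<delta>) * (\<Lambda>3 * (energy_dist S (pull_discrete S n B U') (pull_discrete S n A U))\<^sup>2
                             + \<Lambda>2 * (geo_est S n A)\<^sup>2)"
    and quasi_orth: "\<And>A B U U' l. A \<in> meshes S \<Longrightarrow> B \<in> meshes S \<Longrightarrow> refined_to A B \<Longrightarrow>
          galerkin S n f A U \<Longrightarrow> galerkin S n f B U' \<Longrightarrow>
          l \<in> {geo_est S n A, geo_est S n B} \<Longrightarrow>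
          (energy_dist S (pull_exact S u) (pull_discrete S n A U))\<^sup>2
            - 3 / 2 * (energy_dist S (pull_discrete S n B U') (pull_discrete S n A U))\<^sup>2 - \<Lambda>2 * l\<^sup>2
          \<le> (energy_dist S (pull_exact S u) (pull_discrete S n B U'))\<^sup>2
          \<and> (energy_dist S (pull_exact S u) (pull_discrete S n B U'))\<^sup>2
          \<le> (energy_dist S (pull_exact S u) (pull_discrete S n A U))\<^sup>2
            - 1 / 2 * (energy_dist S (pull_discrete S n B U') (pull_discrete S n A U))\<^sup>2 + \<Lambda>2 * l\<^sup>2"
    and initial: "geo_est S n (initial_mesh S) \<le> 1 / (6 * \<Lambda>0 * L ^ 3)"
    and theta: "0 < \<theta>" "\<theta> \<le> 1"
    and omega: "0 < \<omega>"
          "\<omega> \<le> min (sqrt (C2 / (2 * \<Lambda>0\<^sup>2 * \<Lambda>1)))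
                    (\<xi> * \<theta>\<^sup>2 / (\<Lambda>0 * sqrt (32 * \<Lambda>2 * (2 * \<Lambda>3 + 1))))"
  shows "\<exists>\<alpha> \<beta>. 0 < \<alpha> \<and> \<alpha> < 1 \<and> 0 < \<beta> \<and>
    (\<forall>\<epsilon>0 \<rho>. 0 < \<epsilon>0 \<and> 0 < \<rho> \<and> \<rho> < 1 \<longrightarrow>
      (\<forall>N Tk Tp T U J. afem_run S n b f \<theta> \<omega> \<epsilon>0 \<rho> N Tk Tp T U J \<longrightarrow>
        (\<forall>k j. enat k < N \<and> enat j < J k \<longrightarrow>
          (energy_dist S (pull_exact S u) (pull_discrete S n (T k (Suc j)) (U k (Suc j))))\<^sup>2
            + \<beta> * (est S n f (T k (Suc j)) (U k (Suc j)) (T k (Suc j)))\<^sup>2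
          \<le> \<alpha>\<^sup>2 * ((energy_dist S (pull_exact S u) (pull_discrete S n (T k j) (U k j)))\<^sup>2
            + \<beta> * (est S n f (T k j) (U k j) (T k j))\<^sup>2))) \<and>
      (\<forall>A0. \<exists>Jmax::nat. \<forall>N Tk Tp T U J.
        afem_run S n b f \<theta> \<omega> \<epsilon>0 \<rho> N Tk Tp T U J \<and> Tp 0 = A0 \<longrightarrow>
        (\<forall>k. enat k < N \<longrightarrow> J k \<le> enat Jmax)))"
proof -
  define e where "e A V = (energy_dist S (pull_exact S u) (pull_discrete S n A V))\<^sup>2" for A V
  define \<eta> where "\<eta> A V = (est S n f A V A)\<^sup>2" for A V
  define g where "g A = (geo_est S n A)\<^sup>2" for A
  \<comment> \<open>Marked elements carry the fraction \<open>\<theta>\<^sup>2\<close> of the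
    squared estimator and lose the fraction \<open>\<xi>\<close> of it.\<close>
  define s where "s = \<xi> * \<theta>\<^sup>2"
  \<comment> \<open>The constant of the upper bound once \<open>g\<close> is replaced by
    \<open>(\<Lambda>0 * \<omega>)\<^sup>2\<close> times the squared estimator.\<close>
  define C where "C = C1 + \<Lambda>1 * (\<Lambda>0 * \<omega>)\<^sup>2"
  define \<beta> where "\<beta> = s / (2 * \<Lambda>3 * (2 - s))"
  define q where "q = 1 - 7 * s * \<beta> / (16 * (C + \<beta>))"
  define D where "D = C1 + \<Lambda>1 + \<Lambda>2 + 2 * \<beta> * (1 + \<Lambda>2 + 2 * \<Lambda>3 * (C1 + \<Lambda>1 + \<Lambda>2))"
  have "0 < real b / real CARD('d)"
    using \<open>1 \<le> b\<close> by simp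
  then have "2 powr (- (real b / real CARD('d))) < 2 powr 0"
    by (intro powr_less_mono) auto
  then have "0 < \<xi>" "\<xi> < 1"
    unfolding xi by simp_all
  have s: "0 < s" "s < 1"
  proof -
    show "0 < s"
      using \<open>0 < \<xi>\<close> theta by (simp add: s_def)
    have "\<xi> * \<theta>\<^sup>2 \<le> \<xi> * 1"
      using \<open>0 < \<xi>\<close> theta by (intro mult_left_mono) (auto simp: power_le_one)
    then show "s < 1"
      using \<open>\<xi> < 1\<close> by (simp add: s_def)
  qed
  have \<beta>: "0 < \<beta>"
    using s pos by (simp add: \<beta>_def)
  have C: "0 < C"
    using pos by (simp add: C_def add_pos_nonneg)
  have D: "0 \<le> D"
    using \<beta> pos by (simp add: D_def)
  have q: "0 < q" "q < 1"
  proof -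
    have "7 * s * \<beta> < 16 * (C + \<beta>)"
      using mult_strict_right_mono[OF s(2) \<beta>] C \<beta> unfolding mult.assoc mult_1 distrib_left
      by linarith
    then show "0 < q"
      using C \<beta> by (simp add: q_def)
    show "q < 1"
      using s C \<beta> by (simp add: q_def)
  qed
  \<comment> \<open>The second bound on \<open>\<omega>\<close>, squared; it is the smallness of the
    geometric term assumed in \<open>total_error_contraction\<close>.\<close>
  have om: "(\<Lambda>0 * \<omega>)\<^sup>2 \<le> s\<^sup>2 / (32 * \<Lambda>2 * (2 * \<Lambda>3 + 1))"
  proof -
    have "\<omega> \<le> s / (\<Lambda>0 * sqrt (32 * \<Lambda>2 * (2 * \<Lambda>3 + 1)))"
      using omega(2) by (simp add: s_def)
    then have "\<Lambda>0 * \<omega> \<le> \<Lambda>0 * (s / (\<Lambda>0 * sqrt (32 * \<Lambda>2 * (2 * \<Lambda>3 + 1))))"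
      using pos by (intro mult_left_mono) auto
    also have "\<dots> = s / sqrt (32 * \<Lambda>2 * (2 * \<Lambda>3 + 1))"
      using pos by simp
    finally have "(\<Lambda>0 * \<omega>)\<^sup>2 \<le> (s / sqrt (32 * \<Lambda>2 * (2 * \<Lambda>3 + 1)))\<^sup>2"
      using pos omega(1) by (intro power_mono) auto
    then show ?thesis
      using pos by (simp add: power_divide)
  qed

  \<comment> \<open>Comparison of two meshes\<close>
  have upper': "e A V \<le> C1 * \<eta> A V + \<Lambda>1 * g A" if "A \<in> meshes S" "galerkin S n f A V" for A V
    using upper[OF that] by (simp add: e_def \<eta>_def g_def)

  have perturb: "e B V' + \<beta> * \<eta> B V' \<le> D * (\<eta> A V + g A)"
    if AB: "A \<in> meshes S" "B \<in> meshes S" "refined_to A B"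
      "galerkin S n f A V" "galerkin S n f B V'" for A B V V'
  proof -
    define E where "E = (energy_dist S (pull_discrete S n B V') (pull_discrete S n A V))\<^sup>2"
    have "e B V' \<le> e A V - 1 / 2 * E + \<Lambda>2 * g A"
      using quasi_orth[OF AB, of "geo_est S n A"] by (simp add: e_def g_def E_def)
    \<comment> \<open>With the empty set marked, the bisection condition is vacuous;
      \<open>\<delta> = 1\<close> makes both factors equal to 2.\<close>
    moreover have "\<eta> B V' \<le> 2 * \<eta> A V + 2 * (\<Lambda>3 * E + \<Lambda>2 * g A)"
      using reduction[OF AB, of "{}" 1]
      by (simp add: \<eta>_def g_def E_def bisected_at_least_def est_def)
    ultimately show ?thesis
      unfolding D_def using \<beta> pos upper'[OF AB(1,4)]
      by (intro total_error_perturbation) (auto simp: e_def \<eta>_def g_def E_def)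
  qed

  have contract: "e B V' + \<beta> * \<eta> B V' \<le> q * (e A V + \<beta> * \<eta> A V)"
    if A: "A \<in> meshes S" and gal: "galerkin S n f A V" "galerkin S n f B V'"
      and mark: "mark_module S n f \<theta> A V M" and refine: "refine_module S b A M B"
      and geo: "g A \<le> (\<Lambda>0 * \<omega>)\<^sup>2 * \<eta> A V" for A B V V' M
  proof -
    define E where "E = (energy_dist S (pull_discrete S n B V') (pull_discrete S n A V))\<^sup>2"
    define \<delta> where "\<delta> = s / (2 * (1 - s))"
    have \<delta>: "0 < \<delta>"
      using s by (simp add: \<delta>_def)
    note AB = A refine_module_mesh[OF refine] gal
    have "0 \<le> \<eta> A V"
      by (simp add: \<eta>_def)
    \<comment> \<open>Squaring the marking condition requires the estimator to be
      nonnegative.\<close>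
    have "(\<theta> * est S n f A V A)\<^sup>2 \<le> (est S n f A V M)\<^sup>2"
      using mark theta est_nonneg[of S n f A V A]
      by (intro power_mono) (auto simp: mark_module_def)
    then have "\<xi> * (\<theta>\<^sup>2 * \<eta> A V) \<le> \<xi> * (est S n f A V M)\<^sup>2"
      using \<open>0 < \<xi>\<close> by (intro mult_left_mono) (auto simp: \<eta>_def power_mult_distrib)
    then have "\<eta> A V - \<xi> * (est S n f A V M)\<^sup>2 \<le> (1 - s) * \<eta> A V"
      by (simp add: s_def algebra_simps)
    then have "(1 + \<delta>) * (\<eta> A V - \<xi> * (est S n f A V M)\<^sup>2) \<le> (1 + \<delta>) * ((1 - s) * \<eta> A V)"
      using \<delta> by (intro mult_left_mono) auto
    then have red: "\<eta> B V' \<le> (1 + \<delta>) * ((1 - s) * \<eta> A V) + (1 + 1 / \<delta>) * (\<Lambda>3 * E + \<Lambda>2 * g A)"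
      using reduction[OF AB refine_module_bisected[OF refine A] \<delta>]
      unfolding \<eta>_def g_def E_def by linarith
    have orth: "e B V' \<le> e A V - 1 / 2 * E + \<Lambda>2 * g A"
      using quasi_orth[OF AB, of "geo_est S n A"] by (simp add: e_def g_def E_def)
    have "g A \<le> s\<^sup>2 / (32 * \<Lambda>2 * (2 * \<Lambda>3 + 1)) * \<eta> A V"
      using geo mult_right_mono[OF om \<open>0 \<le> \<eta> A V\<close>] by linarith
    moreover have "e A V \<le> C * \<eta> A V"
    proof -
      have "\<Lambda>1 * g A \<le> \<Lambda>1 * ((\<Lambda>0 * \<omega>)\<^sup>2 * \<eta> A V)"
        using geo pos by (intro mult_left_mono) auto
      then show ?thesis
        using upper'[OF A gal(1)] unfolding C_def distrib_right mult.assoc by linarith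
    qed
    ultimately show ?thesis
      using total_error_contraction[OF s C pos(5,6) \<open>0 \<le> \<eta> A V\<close> orth red[unfolded \<delta>_def]]
      by (simp add: \<beta>_def q_def)
  qed

  \<comment> \<open>Iterates within one call\<close>
  have inner: "T k j \<in> meshes S \<and> galerkin S n f (T k j) (U k j) \<and>
      g (T k j) \<le> (\<Lambda>0 * \<omega>)\<^sup>2 * (\<epsilon>0 * \<rho> ^ k)\<^sup>2"
    if run: "afem_run S n b f \<theta> \<omega> \<epsilon>0 \<rho> N Tk Tp T U J" and k: "enat k < N" and j: "enat j \<le> J k"
    for \<epsilon>0 \<rho> N Tk Tp T U J k j
  proof -
    have pde: "adapt_pde_run S n b f \<theta> (\<epsilon>0 * \<rho> ^ k) (Tp k) (T k) (U k) (J k)"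
      and surf: "adapt_surface S n b (\<omega> * (\<epsilon>0 * \<rho> ^ k)) (Tk k) (Tp k)"
      using run k unfolding afem_run_def by blast+
    have Tp: "Tp k \<in> meshes S"
      using afem_run_outer_mesh[OF run surface k] by simp
    have Tj: "T k j \<in> meshes S" "refined_to (Tp k) (T k j)"
      using adapt_pde_run_mesh[OF pde Tp j] by simp_all
    \<comment> \<open>Each iterate is compared directly with the input mesh, so
      \<open>\<Lambda>0\<close> enters only once, however large \<open>j\<close> is.\<close>
    have "geo_est S n (T k j) \<le> \<Lambda>0 * geo_est S n (Tp k)"
      using quasi_mono Tp Tj by blast
    also have "\<dots> \<le> \<Lambda>0 * (\<omega> * (\<epsilon>0 * \<rho> ^ k))"
      using adapt_surface_geo_est[OF surf] mesh_finite[OF Tp] mesh_nonempty[OF surface Tp] pos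
      by (intro mult_left_mono) auto
    finally have "g (T k j) \<le> (\<Lambda>0 * (\<omega> * (\<epsilon>0 * \<rho> ^ k)))\<^sup>2"
      unfolding g_def using mesh_finite[OF Tj(1)] mesh_nonempty[OF surface Tj(1)]
      by (intro power_mono geo_est_nonneg)
    then show ?thesis
      using pde j Tj by (simp add: adapt_pde_run_def power_mult_distrib mult.assoc)
  qed

  have step: "e (T k (Suc j)) (U k (Suc j)) + \<beta> * \<eta> (T k (Suc j)) (U k (Suc j))
      \<le> q * (e (T k j) (U k j) + \<beta> * \<eta> (T k j) (U k j)) \<and>
      (\<epsilon>0 * \<rho> ^ k)\<^sup>2 \<le> \<eta> (T k j) (U k j)"
    if par: "0 < \<epsilon>0" "0 < \<rho>" and run: "afem_run S n b f \<theta> \<omega> \<epsilon>0 \<rho> N Tk Tp T U J"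
      and k: "enat k < N" and j: "enat j < J k"
    for \<epsilon>0 \<rho> N Tk Tp T U J k j
  proof -
    have pde: "adapt_pde_run S n b f \<theta> (\<epsilon>0 * \<rho> ^ k) (Tp k) (T k) (U k) (J k)"
      using run k unfolding afem_run_def by blast
    have j': "enat (Suc j) \<le> J k"
      using j by (simp add: Suc_ile_eq)
    obtain M where M: "mark_module S n f \<theta> (T k j) (U k j) M"
        "refine_module S b (T k j) M (T k (Suc j))"
      and "\<epsilon>0 * \<rho> ^ k \<le> est S n f (T k j) (U k j) (T k j)"
      using pde j unfolding adapt_pde_run_def by blast
    then have \<epsilon>: "(\<epsilon>0 * \<rho> ^ k)\<^sup>2 \<le> \<eta> (T k j) (U k j)"
      unfolding \<eta>_def using par by (intro power_mono) auto
    have "g (T k j) \<le> (\<Lambda>0 * \<omega>)\<^sup>2 * \<eta> (T k j) (U k j)"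
      using inner[OF run k order_less_imp_le[OF j]] mult_left_mono[OF \<epsilon>, of "(\<Lambda>0 * \<omega>)\<^sup>2"]
      by simp
    then show ?thesis
      using contract[OF _ _ _ M] inner[OF run k order_less_imp_le[OF j]] inner[OF run k j'] \<epsilon>
      by blast
  qed

  \<comment> \<open>While the loop continues, the total error is at least \<open>\<beta>\<close>
    times the squared tolerance; contraction bounds it from above.\<close>
  have decay: "\<beta> * (\<epsilon>0 * \<rho> ^ k)\<^sup>2 \<le> q ^ j * (e (T k 0) (U k 0) + \<beta> * \<eta> (T k 0) (U k 0))"
    if par: "0 < \<epsilon>0" "0 < \<rho>" and run: "afem_run S n b f \<theta> \<omega> \<epsilon>0 \<rho> N Tk Tp T U J"
      and k: "enat k < N" and j: "enat j < J k"
    for \<epsilon>0 \<rho> N Tk Tp T U J k j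
  proof -
    have "e (T k j) (U k j) + \<beta> * \<eta> (T k j) (U k j)
        \<le> q ^ j * (e (T k 0) (U k 0) + \<beta> * \<eta> (T k 0) (U k 0))"
      using j
    proof (induction j)
      case (Suc j)
      then have j: "enat j < J k"
        by (meson enat_ord_simps(2) lessI less_trans)
      show ?case
        using step[OF par run k j] mult_left_mono[OF Suc.IH[OF j] order_less_imp_le[OF q(1)]]
        unfolding power_Suc mult.assoc by linarith
    qed simp
    moreover have "\<beta> * (\<epsilon>0 * \<rho> ^ k)\<^sup>2 \<le> \<beta> * \<eta> (T k j) (U k j)"
      using step[OF par run k j] \<beta> by (intro mult_left_mono) auto
    moreover have "0 \<le> e (T k j) (U k j)"
      by (simp add: e_def)
    ultimately show ?thesis
      by linarith
  qed

  \<comment> \<open>For \<open>k = 0\<close> the initial error is controlled through one fixed Galerkin solution on the input mesh,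
    for \<open>k > 0\<close> through the tolerance reached by the previous call; both are comparable to the
    current tolerance.\<close>
  have bounded: "\<exists>Jmax::nat. \<forall>N Tk Tp T U J.
      afem_run S n b f \<theta> \<omega> \<epsilon>0 \<rho> N Tk Tp T U J \<and> Tp 0 = A0 \<longrightarrow>
      (\<forall>k. enat k < N \<longrightarrow> J k \<le> enat Jmax)"
    if par: "0 < \<epsilon>0" "0 < \<rho>" for \<epsilon>0 \<rho> A0
  proof -
    \<comment> \<open>Chosen from \<open>A0\<close> alone, so that the bound does not depend on the
      run; a run entering call 0 with \<open>A0\<close> shows that such a \<open>V\<close>
      exists.\<close>
    define V0 where "V0 = (SOME V. galerkin S n f A0 V)"
    \<comment> \<open>The first entry serves \<open>k = 0\<close>, the second \<open>k > 0\<close>;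
      \<open>1 / \<rho>\<^sup>2\<close> accounts for the step from the previous tolerance to the
      current one.\<close>
    define B where "B = max (D * (\<eta> A0 V0 + g A0) / \<epsilon>0\<^sup>2) (D * (1 + (\<Lambda>0 * \<omega>)\<^sup>2) / \<rho>\<^sup>2)"
    obtain m where m: "\<And>j. \<beta> \<le> q ^ j * B \<Longrightarrow> j < m"
      using geometric_decay_bounded[OF q \<beta>] by blast
    have "J k \<le> enat m"
      if run: "afem_run S n b f \<theta> \<omega> \<epsilon>0 \<rho> N Tk Tp T U J" and A0: "Tp 0 = A0" and k: "enat k < N"
      for N Tk Tp T U J k
    proof -
      have start: "e (T k 0) (U k 0) + \<beta> * \<eta> (T k 0) (U k 0) \<le> B * (\<epsilon>0 * \<rho> ^ k)\<^sup>2"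
      proof (cases k)
        case 0
        have "adapt_pde_run S n b f \<theta> (\<epsilon>0 * \<rho> ^ k) (Tp k) (T k) (U k) (J k)"
          using run k unfolding afem_run_def by blast
        then have T0: "T k 0 = A0"
          using A0 0 by (simp add: adapt_pde_run_def)
        have *: "A0 \<in> meshes S" "galerkin S n f A0 (U k 0)"
          using inner[OF run k, of 0] T0 by (simp_all add: zero_enat_def[symmetric])
        have "galerkin S n f A0 V0"
          unfolding V0_def using *(2) by (rule someI[of "galerkin S n f A0"])
        \<comment> \<open>\<open>A0\<close> counts as a refinement of itself, so
          \<open>perturb\<close> compares the solution of the run with \<open>V0\<close>.\<close>
        then have "e (T k 0) (U k 0) + \<beta> * \<eta> (T k 0) (U k 0) \<le> D * (\<eta> A0 V0 + g A0)"
          using perturb[of A0 A0 V0 "U k 0"] * T0 by simp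
        also have "\<dots> = D * (\<eta> A0 V0 + g A0) / \<epsilon>0\<^sup>2 * (\<epsilon>0 * \<rho> ^ k)\<^sup>2"
          using par 0 by simp
        also have "\<dots> \<le> B * (\<epsilon>0 * \<rho> ^ k)\<^sup>2"
          by (intro mult_right_mono) (auto simp: B_def)
        finally show ?thesis .
      next
        case (Suc i)
        then have i: "enat i < N" "enat (Suc i) < N"
          using k by (auto intro: less_trans[of "enat i" "enat (Suc i)"])
        define c where "c = (\<epsilon>0 * \<rho> ^ i)\<^sup>2"
        obtain j where j: "J i = enat j" "Tk k = T i j"
          using run i Suc unfolding afem_run_def by blast
        have pde: "adapt_pde_run S n b f \<theta> (\<epsilon>0 * \<rho> ^ i) (Tp i) (T i) (U i) (J i)"
            "adapt_pde_run S n b f \<theta> (\<epsilon>0 * \<rho> ^ k) (Tp k) (T k) (U k) (J k)"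
          using run i k unfolding afem_run_def by blast+
        have "est S n f (T i j) (U i j) (T i j) < \<epsilon>0 * \<rho> ^ i"
          using pde(1) j by (simp add: adapt_pde_run_def)
        then have "\<eta> (T i j) (U i j) \<le> c"
          unfolding \<eta>_def c_def by (intro power_mono est_nonneg) simp
        moreover have old: "T i j \<in> meshes S" "galerkin S n f (T i j) (U i j)"
            "g (T i j) \<le> (\<Lambda>0 * \<omega>)\<^sup>2 * c"
          using inner[OF run i(1), of j] j by (simp_all add: c_def)
        ultimately have "D * (\<eta> (T i j) (U i j) + g (T i j)) \<le> D * ((1 + (\<Lambda>0 * \<omega>)\<^sup>2) * c)"
          using D by (intro mult_left_mono) (auto simp: distrib_right)
        moreover have "T k 0 = Tp k"
          using pde(2) by (simp add: adapt_pde_run_def)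
        moreover have "galerkin S n f (T k 0) (U k 0)"
          using inner[OF run k, of 0] by (simp add: zero_enat_def[symmetric])
        ultimately have "e (T k 0) (U k 0) + \<beta> * \<eta> (T k 0) (U k 0)
            \<le> D * ((1 + (\<Lambda>0 * \<omega>)\<^sup>2) * c)"
          using perturb[of "T i j" "T k 0" "U i j" "U k 0"] old(1,2) j(2)
            afem_run_outer_mesh[OF run surface k] by simp
        also have "\<dots> = D * (1 + (\<Lambda>0 * \<omega>)\<^sup>2) / \<rho>\<^sup>2 * (\<epsilon>0 * \<rho> ^ k)\<^sup>2"
          using par Suc by (simp add: c_def power_mult_distrib)
        also have "\<dots> \<le> B * (\<epsilon>0 * \<rho> ^ k)\<^sup>2"
          by (intro mult_right_mono) (auto simp: B_def)
        finally show ?thesis .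
      qed
      have less: "j < m" if j: "enat j < J k" for j
      proof (rule m)
        have "\<beta> * (\<epsilon>0 * \<rho> ^ k)\<^sup>2 \<le> q ^ j * (B * (\<epsilon>0 * \<rho> ^ k)\<^sup>2)"
          using decay[OF par run k j] start q
          by (meson mult_left_mono order_trans zero_le_power order_less_imp_le)
        then have "\<beta> * (\<epsilon>0 * \<rho> ^ k)\<^sup>2 \<le> (q ^ j * B) * (\<epsilon>0 * \<rho> ^ k)\<^sup>2"
          by (simp only: mult.assoc)
        then show "\<beta> \<le> q ^ j * B"
          using par by (subst (asm) mult_le_cancel_right_pos) auto
      qed
      \<comment> \<open>If \<open>J k\<close> exceeded \<open>m\<close>, possibly being infinite,
        then \<open>less\<close> at \<open>j = m\<close> would give \<open>m < m\<close>.\<close>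
      show ?thesis
        using less[of m] by (meson less_irrefl not_le)
    qed
    then show ?thesis
      by blast
  qed

  \<comment> \<open>The contraction was proved for squared quantities with factor \<open>q\<close>,
    so \<open>\<alpha>\<close> is its square root.\<close>
  have sq: "(sqrt q)\<^sup>2 = q"
    using q by simp
  show ?thesis
  proof (rule exI[of _ "sqrt q"], rule exI[of _ \<beta>], intro conjI allI impI; (elim conjE)?)
    fix \<epsilon>0 \<rho> N Tk Tp T U J k j
    assume "0 < \<epsilon>0" "0 < \<rho>" "afem_run S n b f \<theta> \<omega> \<epsilon>0 \<rho> N Tk Tp T U J"
      "enat k < N" "enat j < J k"
    from step[OF this] show
      "(energy_dist S (pull_exact S u) (pull_discrete S n (T k (Suc j)) (U k (Suc j))))\<^sup>2
         + \<beta> * (est S n f (T k (Suc j)) (U k (Suc j)) (T k (Suc j)))\<^sup>2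
       \<le> (sqrt q)\<^sup>2 * ((energy_dist S (pull_exact S u) (pull_discrete S n (T k j) (U k j)))\<^sup>2
         + \<beta> * (est S n f (T k j) (U k j) (T k j))\<^sup>2)"
      by (simp only: e_def \<eta>_def sq)
  next
    fix \<epsilon>0 \<rho> :: real and A0
    assume "0 < \<epsilon>0" "0 < \<rho>"
    then show "\<exists>Jmax::nat. \<forall>N Tk Tp T U J.
        afem_run S n b f \<theta> \<omega> \<epsilon>0 \<rho> N Tk Tp T U J \<and> Tp 0 = A0 \<longrightarrow>
        (\<forall>k. enat k < N \<longrightarrow> J k \<le> enat Jmax)"
      by (rule bounded)
  qed (use q \<beta> in simp_all)
qed

end
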